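(* For every $\delta\in(0,1)$ there is an algorithm for the hereditary maximin share problem which, given $n$ agents and $m$ items of a hereditary set system $H=(J,\mathcal{F})$, with each agent's valuation $v_i$ accessible only through a valuation oracle, makes a number of oracle queries and performs an amount of additional computation that is polynomial in $n$ and $m$ (for fixed $\delta$), and outputs pairwise disjoint bundles $S_1,\dots,S_n\subseteq J$ such that $v_i(S_i)\ge (1-\delta)\cdot\frac{11}{30}\cdot {\tt MMS}(i)$ for every agent $i$.
   Context: A hereditary set system $H=(J,\mathcal{F})$ consists of a finite set $J$ of items and a nonempty family $\mathcal{F}$ of subsets of $J$ such that $S\in\mathcal{F}$ and $T\subseteq S$ imply $T\in\mathcal{F}$. Agent $i$ has a nonnegative value $v_{i,j}$ for each item $j$, and for any $S\subseteq J$, $v_i(S)=\max_{T\in\mathcal{F},\,T\subseteq S}\sum_{j\in T}v_{i,j}$. The maximin share of agent $i$ is ${\tt MMS}(i)=\max_{\mathcal{P}}\min_{P\in\mathcal{P}}v_i(P)$, the maximum taken over all partitions $\mathcal{P}$ of $J$ into $n$ (possibly empty) parts. A valuation oracle for agent $i$ returns $v_i(S)$ when queried with a subset $S\subseteq J$. *)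

theory Defs
  imports Complex_Main "HOL-Library.Disjoint_Sets"
begin

definition hereditary_system :: "'a set \<Rightarrow> 'a set set \<Rightarrow> bool" where
  "hereditary_system J F \<longleftrightarrow>
     finite J \<and> F \<noteq> {} \<and> F \<subseteq> Pow J \<and> (\<forall>S\<in>F. \<forall>T. T \<subseteq> S \<longrightarrow> T \<in> F)"

definition valuation :: "'a set set \<Rightarrow> ('a \<Rightarrow> real) \<Rightarrow> 'a set \<Rightarrow> real" where
  "valuation F w S = Max {(\<Sum>j\<in>T. w j) | T. T \<in> F \<and> T \<subseteq> S}"

text \<open>Parts are indexed by the numbers below \<open>n\<close>, so that several of them may be empty.\<close>

definition mms :: "'a set \<Rightarrow> nat \<Rightarrow> ('a set \<Rightarrow> real) \<Rightarrow> real" where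
  "mms J n u = Max {Min ((\<lambda>k. u (P k)) ` {..<n}) | P.
     disjoint_family_on P {..<n} \<and> (\<Union>k<n. P k) = J}"

text \<open>
  Algorithms are programs of a random access machine with access to a valuation oracle. Memory
  consists of named arrays of natural numbers and named arrays of reals; entry 0 of an array
  serves as a scalar variable. Every primitive step has unit cost (an expression has constant
  size, as the program is fixed). The operations are limited so that unit cost is a legitimate
  measure of polynomial time: there is no multiplication of stored values, no rounding, and all
  real constants of a program are rational. Hence, after \<open>t\<close> steps on rational data, the
  bit lengths of all stored numbers are bounded by a polynomial in \<open>t\<close> and in the bit length
  of the data, and no advice can be hidden in a real constant.
\<close>

datatype nexp =
    NConst nat
  | NElem string nexp
  | NPlus nexp nexp
  | NMinus nexp nexp

datatype rexp =
    RConst rat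
  | RElem string nexp
  | RPlus rexp rexp
  | RScale rat rexp

datatype bexp =
    NLess nexp nexp
  | RLess rexp rexp
  | BNot bexp
  | BAnd bexp bexp

datatype com =
    Skip
  | NAssign string nexp nexp
  | RAssign string nexp rexp
  | Query string nexp nexp string
  | Seq com com
  | Cond bexp com com
  | While bexp com

record state =
  nats :: "string \<Rightarrow> nat \<Rightarrow> nat"
  reals :: "string \<Rightarrow> nat \<Rightarrow> real"

fun nval :: "nexp \<Rightarrow> state \<Rightarrow> nat" where
  "nval (NConst k) s = k"
| "nval (NElem x a) s = nats s x (nval a s)"
| "nval (NPlus a b) s = nval a s + nval b s"
| "nval (NMinus a b) s = nval a s - nval b s"

fun rval :: "rexp \<Rightarrow> state \<Rightarrow> real" where
  "rval (RConst p) s = of_rat p"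
| "rval (RElem x a) s = reals s x (nval a s)"
| "rval (RPlus a b) s = rval a s + rval b s"
| "rval (RScale p a) s = of_rat p * rval a s"

fun bval :: "bexp \<Rightarrow> state \<Rightarrow> bool" where
  "bval (NLess a b) s \<longleftrightarrow> nval a s < nval b s"
| "bval (RLess a b) s \<longleftrightarrow> rval a s < rval b s"
| "bval (BNot b) s \<longleftrightarrow> \<not> bval b s"
| "bval (BAnd b c) s \<longleftrightarrow> bval b s \<and> bval c s"

definition nwrite :: "string \<Rightarrow> nat \<Rightarrow> nat \<Rightarrow> state \<Rightarrow> state" where
  "nwrite x k a s = s\<lparr>nats := (nats s)(x := (nats s x)(k := a))\<rparr>"

definition rwrite :: "string \<Rightarrow> nat \<Rightarrow> real \<Rightarrow> state \<Rightarrow> state" where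
  "rwrite x k r s = s\<lparr>reals := (reals s)(x := (reals s x)(k := r))\<rparr>"

text \<open>
  \<open>exec orc c s q t s'\<close>: program \<open>c\<close>, started in \<open>s\<close>, halts in \<open>s'\<close> after \<open>q\<close> oracle queries
  and \<open>t\<close> steps in total. The instruction \<open>Query x a i y\<close> stores in entry \<open>a\<close> of the real
  array \<open>x\<close> the oracle's answer for agent \<open>i\<close> and the set whose characteristic vector is
  the array \<open>y\<close>; the entries of \<open>y\<close> have been paid for when they were written.
\<close>

inductive exec ::
  "(nat \<Rightarrow> nat set \<Rightarrow> real) \<Rightarrow> com \<Rightarrow> state \<Rightarrow> nat \<Rightarrow> nat \<Rightarrow> state \<Rightarrow> bool"
  for orc :: "nat \<Rightarrow> nat set \<Rightarrow> real"
where
  Skip: "exec orc Skip s 0 1 s"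
| NAssign: "exec orc (NAssign x a e) s 0 1 (nwrite x (nval a s) (nval e s) s)"
| RAssign: "exec orc (RAssign x a e) s 0 1 (rwrite x (nval a s) (rval e s) s)"
| Query: "exec orc (Query x a i y) s 1 1
            (rwrite x (nval a s) (orc (nval i s) {j. nats s y j \<noteq> 0}) s)"
| Seq: "exec orc c1 s q1 t1 s1 \<Longrightarrow> exec orc c2 s1 q2 t2 s2 \<Longrightarrow>
          exec orc (Seq c1 c2) s (q1 + q2) (t1 + t2) s2"
| CondTrue: "bval b s \<Longrightarrow> exec orc c1 s q t s' \<Longrightarrow> exec orc (Cond b c1 c2) s q (t + 1) s'"
| CondFalse: "\<not> bval b s \<Longrightarrow> exec orc c2 s q t s' \<Longrightarrow> exec orc (Cond b c1 c2) s q (t + 1) s'"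
| WhileFalse: "\<not> bval b s \<Longrightarrow> exec orc (While b c) s 0 1 s"
| WhileTrue: "bval b s \<Longrightarrow> exec orc c s q1 t1 s1 \<Longrightarrow> exec orc (While b c) s1 q2 t2 s2 \<Longrightarrow>
          exec orc (While b c) s (q1 + q2) (t1 + t2 + 1) s2"

lemma exec_deterministic:
  "exec orc c s q t s' \<Longrightarrow> exec orc c s q2 t2 s2 \<Longrightarrow> q2 = q \<and> t2 = t \<and> s2 = s'"
proof (induction arbitrary: q2 t2 s2 rule: exec.induct)
  case (Seq c1 s q1 t1 s1 c2 q2' t2' s2')
  from Seq.prems show ?case
    by (cases rule: exec.cases) (use Seq.IH in blast)+
next
  case (WhileTrue b s c q1 t1 s1 q2' t2' s2')
  from WhileTrue.prems show ?case
    by (cases rule: exec.cases) (use WhileTrue.hyps(1) WhileTrue.IH in blast)+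
next
  case (CondTrue b s c1 q t s' c2)
  from CondTrue.prems show ?case
    by (cases rule: exec.cases) (use CondTrue.hyps(1) CondTrue.IH in blast)+
next
  case (CondFalse b s c2 q t s' c1)
  from CondFalse.prems show ?case
    by (cases rule: exec.cases) (use CondFalse.hyps(1) CondFalse.IH in blast)+
qed (auto elim: exec.cases)

text \<open>The program is given only the numbers of agents and items; all else is zero.\<close>

definition init_state :: "nat \<Rightarrow> nat \<Rightarrow> state" where
  "init_state n m =
     \<lparr>nats = (\<lambda>x k. if k = 0 \<and> x = ''n'' then n else if k = 0 \<and> x = ''m'' then m else 0),
      reals = (\<lambda>x k. 0)\<rparr>"

text \<open>
  The result is read off from the array \<open>owner\<close>; an item with an owner that is not one of
  the agents is left unallocated.
\<close>

definition allotted :: "nat \<Rightarrow> state \<Rightarrow> nat \<Rightarrow> nat set" where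
  "allotted m s i = {j. j < m \<and> nats s ''owner'' j = i}"

end

theory Submission
  imports Defs
begin

text \<open>
  Every agent \<open>i\<close> has a threshold \<open>t\<^sub>i\<close>, initially at least \<open>11/30 * MMS(i)\<close>. In a round, the set
  of free items is repeatedly shrunk to a set \<open>S\<close> that is minimal among those worth at least
  \<open>t\<^sub>i\<close> to some waiting agent \<open>i\<close>, and \<open>S\<close> is given to such an agent. Minimality implies
  \<open>S \<in> F\<close>; as \<open>F\<close> is common to all agents, every agent values \<open>S\<close> additively, and for
  every agent still waiting \<open>S\<close> without any one of its items is worth less than the threshold.

  Suppose that agent \<open>i\<close> is still waiting at the end of a round. Each lost item is charged so that
  every bundle that was given away costs at most 16. If \<open>t\<^sub>i \<le> 11/30 * MMS(i)\<close>, then every part of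
  an MMS partition of \<open>i\<close> has lost items of total charge at least 16. There are fewer than \<open>n\<close>
  bundles and there are \<open>n\<close> parts, so \<open>t\<^sub>i > 11/30 * MMS(i)\<close> after all; then \<open>t\<^sub>i\<close> is multiplied
  by \<open>K / (K + 1)\<close> and a new round is started. As the initial threshold exceeds \<open>11/30 * MMS(i)\<close> at
  most \<open>m\<close>-fold, this happens at most \<open>K * m\<close> times for each agent.
\<close>

section \<open>Valuations, maximin shares, and bounds through the values of single items\<close>

lemma finite_valuation_values:
  assumes "finite F"
  shows "finite {(\<Sum>j\<in>T. w j) | T. T \<in> F \<and> T \<subseteq> S}"
  by (rule finite_subset[of _ "(\<lambda>T. \<Sum>j\<in>T. w j) ` F"]) (use assms in auto)

lemma sum_le_valuation:
  assumes "finite F" "T \<in> F" "T \<subseteq> S"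
  shows "(\<Sum>j\<in>T. w j) \<le> valuation F w S"
  unfolding valuation_def
  by (rule Max_ge[OF finite_valuation_values[OF assms(1)]]) (use assms in blast)

lemma valuation_attained:
  assumes "finite F" "{} \<in> F"
  obtains T where "T \<in> F" "T \<subseteq> S" "valuation F w S = (\<Sum>j\<in>T. w j)"
proof -
  have "valuation F w S \<in> {(\<Sum>j\<in>T. w j) | T. T \<in> F \<and> T \<subseteq> S}"
    unfolding valuation_def
    by (rule Max_in[OF finite_valuation_values[OF assms(1)]]) (use assms(2) in blast)
  then show ?thesis using that by blast
qed

lemma valuation_mono:
  assumes "finite F" "{} \<in> F" "S \<subseteq> S'"
  shows "valuation F w S \<le> valuation F w S'"
proof -
  obtain T where "T \<in> F" "T \<subseteq> S" "valuation F w S = (\<Sum>j\<in>T. w j)"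
    using valuation_attained[OF assms(1,2)] .
  then show ?thesis using sum_le_valuation[OF assms(1), of T S' w] assms(3) by auto
qed

lemma valuation_nonneg:
  assumes "finite F" "{} \<in> F"
  shows "0 \<le> valuation F w S"
  using sum_le_valuation[OF assms, of S w] by simp

lemma finite_mms_values:
  fixes n :: nat
  assumes "finite J" "0 < n"
  shows "finite {Min ((\<lambda>k. u (P k)) ` {..<n}) | P.
    disjoint_family_on P {..<n} \<and> (\<Union>k<n. P k) = J}"
proof (rule finite_subset)
  show "{Min ((\<lambda>k. u (P k)) ` {..<n}) | P.
      disjoint_family_on P {..<n} \<and> (\<Union>k<n. P k) = J} \<subseteq> u ` Pow J"
  proof safe
    fix P :: "nat \<Rightarrow> _"
    assume "J = (\<Union>k<n. P k)"
    have "Min ((\<lambda>k. u (P k)) ` {..<n}) \<in> (\<lambda>k. u (P k)) ` {..<n}"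
      by (rule Min_in) (use assms in auto)
    then show "Min ((\<lambda>k. u (P k)) ` {..<n}) \<in> u ` Pow (\<Union>k<n. P k)" by blast
  qed
qed (use assms in simp)

lemma le_mms:
  assumes "finite J" "0 < n" "disjoint_family_on P {..<n}" "(\<Union>k<n. P k) = J"
    and "\<And>k. k < n \<Longrightarrow> c \<le> u (P k)"
  shows "c \<le> mms J n u"
proof -
  have "c \<le> Min ((\<lambda>k. u (P k)) ` {..<n})"
    using assms(2,5) by (subst Min_ge_iff) auto
  also have "\<dots> \<le> mms J n u"
    unfolding mms_def by (rule Max_ge[OF finite_mms_values[OF assms(1,2)]]) (use assms in blast)
  finally show ?thesis .
qed

lemma mms_attained:
  assumes "finite J" "0 < n"
  obtains P where "disjoint_family_on P {..<n}" "(\<Union>k<n. P k) = J"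
    "\<And>k. k < n \<Longrightarrow> mms J n u \<le> u (P k)"
proof -
  let ?P = "\<lambda>k::nat. if k = 0 then J else {}"
  have "disjoint_family_on ?P {..<n} \<and> (\<Union>k<n. ?P k) = J"
    using assms(2) by (auto simp: disjoint_family_on_def split: if_splits)
  then have "mms J n u \<in> {Min ((\<lambda>k. u (P k)) ` {..<n}) | P.
      disjoint_family_on P {..<n} \<and> (\<Union>k<n. P k) = J}"
    unfolding mms_def by (intro Max_in[OF finite_mms_values[OF assms]]) blast
  then obtain P where "disjoint_family_on P {..<n}" "(\<Union>k<n. P k) = J"
    "mms J n u = Min ((\<lambda>k. u (P k)) ` {..<n})" by blast
  then show ?thesis by (intro that[of P]) (simp_all add: Min_le)
qed

text \<open>Fewer than \<open>n\<close> items lie outside the index set of the sum, so some part of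
  an optimal partition avoids them all. The feasible set that gives this part its value then lies
  inside the index set. This bounds the initial threshold from below.\<close>

lemma mms_le_sum_frequent:
  fixes F :: "'a set set" and J :: "'a set" and w :: "'a \<Rightarrow> real"
  defines "u \<equiv> valuation F w"
  assumes H: "hereditary_system J F" and n: "0 < n"
  shows "mms J n u \<le> (\<Sum>j\<in>{j \<in> J. n \<le> card {k \<in> J. u {j} \<le> u {k}}}. u {j})"
proof -
  have J: "finite J" "F \<subseteq> Pow J" and sub: "\<And>S T. S \<in> F \<Longrightarrow> T \<subseteq> S \<Longrightarrow> T \<in> F" and "F \<noteq> {}"
    using H unfolding hereditary_system_def by auto
  have F: "finite F" using J finite_subset by auto
  have F0: "{} \<in> F" using sub \<open>F \<noteq> {}\<close> by blast
  have u0: "0 \<le> u S" for S unfolding u_def by (rule valuation_nonneg[OF F F0])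
  let ?G = "{j \<in> J. n \<le> card {k \<in> J. u {j} \<le> u {k}}}"
  define B where "B = J - ?G"
  have finB: "finite B" using J by (simp add: B_def)
  have "card B < n"
  proof (cases "B = {}")
    case False
    \<comment> \<open>A least valuable item of \<open>B\<close> is counted together with all of
      \<open>B\<close>, and as it lies outside \<open>?G\<close> that count is below
      \<open>n\<close>.\<close>
    then obtain j where j: "j \<in> B" "\<And>k. k \<in> B \<Longrightarrow> u {j} \<le> u {k}"
      using ex_min_if_finite[of "(\<lambda>j. u {j}) ` B"] finB by (force simp: not_less)
    have "card B \<le> card {k \<in> J. u {j} \<le> u {k}}"
      by (rule card_mono) (use J j in \<open>auto simp: B_def\<close>)
    also have "\<dots> < n" using j(1) by (auto simp: B_def)
    finally show ?thesis .
  qed (use n in simp)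
  obtain P where P: "disjoint_family_on P {..<n}" "(\<Union>k<n. P k) = J"
    "\<And>k. k < n \<Longrightarrow> mms J n u \<le> u (P k)"
    using mms_attained[OF J(1) n, of u] by metis
  have "\<exists>k<n. P k \<inter> B = {}"
  proof (rule ccontr)
    assume "\<not> ?thesis"
    then have "\<forall>k\<in>{..<n}. \<exists>b. b \<in> P k \<inter> B" by auto
    then obtain b where b: "\<forall>k\<in>{..<n}. b k \<in> P k \<inter> B" by metis
    have "inj_on b {..<n}"
    proof (rule inj_onI, rule ccontr)
      fix k l assume "k \<in> {..<n}" "l \<in> {..<n}" "b k = b l" "k \<noteq> l"
      moreover from this have "b k \<in> P k" "b k \<in> P l" using bspec[OF b, of k] bspec[OF b, of l] by auto
      ultimately show False using P(1) by (auto simp: disjoint_family_on_def)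
    qed
    moreover have "b ` {..<n} \<subseteq> B" using b by auto
    ultimately have "n \<le> card B" using card_inj_on_le[of b "{..<n}" B] finB by simp
    with \<open>card B < n\<close> show False by simp
  qed
  then obtain k where k: "k < n" "P k \<inter> B = {}" by blast
  obtain T where T: "T \<in> F" "T \<subseteq> P k" "u (P k) = (\<Sum>j\<in>T. w j)"
    using valuation_attained[OF F F0] unfolding u_def by metis
  have TG: "T \<subseteq> ?G" using k T(1,2) J(2) by (auto simp: B_def)
  \<comment> \<open>Membership in the feasible set \<open>T\<close> matters: an item that lies in no
    feasible set has \<open>u {j} = 0\<close> whatever \<open>w j\<close> is.\<close>
  have "w j \<le> u {j}" if "j \<in> T" for j
    using sum_le_valuation[OF F sub[OF T(1)], of "{j}" "{j}" w] that by (simp add: u_def)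
  then have "(\<Sum>j\<in>T. w j) \<le> (\<Sum>j\<in>T. u {j})" by (rule sum_mono)
  also have "\<dots> \<le> (\<Sum>j\<in>?G. u {j})"
    by (rule sum_mono2) (use J TG u0 in auto)
  finally show ?thesis using P(3)[OF k(1)] T(3) by simp
qed

text \<open>Spread \<open>n\<close> items worth at least \<open>u {j}\<close> over the
  \<open>n\<close> parts, one in each.\<close>

lemma frequent_le_mms:
  fixes F :: "'a set set" and J :: "'a set" and w :: "'a \<Rightarrow> real"
  defines "u \<equiv> valuation F w"
  assumes H: "hereditary_system J F" and n: "0 < n"
    and j: "n \<le> card {k \<in> J. u {j} \<le> u {k}}"
  shows "u {j} \<le> mms J n u"
proof -
  have J: "finite J" "F \<subseteq> Pow J" and sub: "\<And>S T. S \<in> F \<Longrightarrow> T \<subseteq> S \<Longrightarrow> T \<in> F" and "F \<noteq> {}"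
    using H unfolding hereditary_system_def by auto
  have F: "finite F" using J finite_subset by auto
  have F0: "{} \<in> F" using sub \<open>F \<noteq> {}\<close> by blast
  let ?G = "{k \<in> J. u {j} \<le> u {k}}"
  have "finite ?G" using J by simp
  then obtain e where e: "e ` {..<n} \<subseteq> ?G" "inj_on e {..<n}"
    using card_le_inj[of "{..<n}" ?G] j by auto
  \<comment> \<open>Part 0 keeps \<open>e 0\<close> together with every item not placed elsewhere,
    so that the parts cover \<open>J\<close>.\<close>
  define P where "P k = (if k = 0 then J - e ` {1..<n} else {e k})" for k :: nat
  have eP: "e k \<in> P k" if "k < n" for k
    using that e inj_onD[OF e(2)] by (fastforce simp: P_def)
  show ?thesis
  proof (rule le_mms[OF J(1) n])
    show "disjoint_family_on P {..<n}"
      using inj_onD[OF e(2)] by (fastforce simp: disjoint_family_on_def P_def)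
    show "(\<Union>k<n. P k) = J"
    proof
      show "(\<Union>k<n. P k) \<subseteq> J" using e(1) by (auto simp: P_def split: if_splits)
      show "J \<subseteq> (\<Union>k<n. P k)"
      proof
        fix x assume "x \<in> J"
        show "x \<in> (\<Union>k<n. P k)"
        proof (cases "x \<in> e ` {1..<n}")
          case True
          then obtain k where "1 \<le> k" "k < n" "x = e k" by auto
          then show ?thesis by (intro UN_I[of k]) (auto simp: P_def)
        next
          case False
          then show ?thesis using \<open>x \<in> J\<close> n by (intro UN_I[of 0]) (auto simp: P_def)
        qed
      qed
    qed
    show "u {j} \<le> u (P k)" if "k < n" for k
    proof -
      have "u {j} \<le> u {e k}" using e(1) that by auto
      also have "\<dots> \<le> u (P k)"
        unfolding u_def by (rule valuation_mono[OF F F0]) (use eP[OF that] in simp)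
      finally show ?thesis .
    qed
  qed
qed

lemma mms_nonneg:
  assumes H: "hereditary_system J F" and n: "0 < n"
  shows "0 \<le> mms J n (valuation F w)"
proof -
  have J: "finite J" "F \<subseteq> Pow J" "{} \<in> F"
    using H unfolding hereditary_system_def by blast+
  then have F: "finite F" using finite_subset by auto
  obtain P where P: "disjoint_family_on P {..<n}" "(\<Union>k<n. P k) = J"
    using mms_attained[OF J(1) n] by metis
  show ?thesis by (rule le_mms[OF J(1) n P]) (rule valuation_nonneg[OF F J(3)])
qed

lemma sum_frequent_le:
  fixes F :: "'a set set" and J :: "'a set" and w :: "'a \<Rightarrow> real"
  defines "u \<equiv> valuation F w"
  assumes H: "hereditary_system J F" and n: "0 < n"
  shows "(\<Sum>j\<in>{j \<in> J. n \<le> card {k \<in> J. u {j} \<le> u {k}}}. u {j}) \<le> real (card J) * mms J n u"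
proof -
  have J: "finite J" using H unfolding hereditary_system_def by blast
  let ?G = "{j \<in> J. n \<le> card {k \<in> J. u {j} \<le> u {k}}}"
  have "(\<Sum>j\<in>?G. u {j}) \<le> (\<Sum>j\<in>?G. mms J n u)"
    by (rule sum_mono) (use frequent_le_mms[OF H n] in \<open>simp add: u_def\<close>)
  also have "\<dots> = real (card ?G) * mms J n u" by simp
  also have "\<dots> \<le> real (card J) * mms J n u"
    by (rule mult_right_mono) (use J mms_nonneg[OF H n] card_mono[of J ?G] in \<open>auto simp: u_def\<close>)
  finally show ?thesis .
qed

text \<open>Bernoulli's inequality gives \<open>1 + f / K <= (1 + 1 / K) ^ f\<close>, while the
  hypotheses force \<open>(1 + 1 / K) ^ f * M < m * M\<close>. Later \<open>f\<close> is the number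
  of times that a threshold starting at \<open>B\<close> has been lowered, and \<open>M\<close> is
  the target it still exceeds.\<close>

lemma geometric_decrease_bound:
  fixes B M :: real and f K m :: nat
  assumes "0 < K" "0 \<le> M" "B \<le> real m * M" "M < (real K / (real K + 1)) ^ f * B"
  shows "f < K * m"
proof -
  define b where "b = real K / (real K + 1)"
  have b: "0 < b" using assms(1) by (simp add: b_def)
  have ib: "1 / b = 1 + 1 / real K" using assms(1) by (simp add: b_def field_simps)
  have "1 + real f * (1 / real K) \<le> (1 + 1 / real K) ^ f"
    by (rule Bernoulli_inequality) (use assms(1) in \<open>simp add: field_simps\<close>)
  then have "M * (1 + real f / real K) \<le> M * (1 + 1 / real K) ^ f"
    using assms(2) by (simp add: mult_left_mono)
  also have "\<dots> = M * (1 / b) ^ f" by (simp add: ib)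
  also have "\<dots> < B"
    using assms(4) b by (simp add: b_def[symmetric] power_one_over divide_less_eq mult.commute)
  finally have "M * (1 + real f / real K) < M * real m" using assms(3) by (simp add: mult.commute)
  then have "1 + real f / real K < real m"
    using assms(2) by (metis mult_less_cancel_left not_less)
  then have "real f < real K * real m" using assms(1) by (simp add: field_simps)
  then show ?thesis by (metis of_nat_less_iff of_nat_mult)
qed

section \<open>The charging argument\<close>

text \<open>
  Values are scaled so that the threshold is 11 and the parts of an MMS partition are worth at
  least 30. Among the bundles of at least three items the tight one is a triple whose items have
  value 11/2 each.
\<close>

definition charge :: "real \<Rightarrow> real" where
  "charge x = (if x < 17/4 then 16 / 15 * x else (16 * x - 8) / 15)"

lemma charge_nonneg: "0 \<le> x \<Longrightarrow> 0 \<le> charge x"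
  by (auto simp: charge_def)

lemma charge_le: "charge x \<le> 16 / 15 * x"
  by (auto simp: charge_def)

text \<open>Here \<open>k\<close> counts the large items, those of value at least 17/4. Each costs
  at least 4, its charge at the cutoff, and each saves 8/15 against the linear charge
  \<open>16 / 15 * x\<close>. With that rebate three items of value 11/2 cost exactly 3 * (88 - 8) /
  15 = 16.\<close>

lemma sum_charge_ge:
  fixes x :: "'a \<Rightarrow> real"
  assumes "finite B" "\<And>j. j \<in> B \<Longrightarrow> 0 \<le> x j"
  obtains k :: nat where "4 * real k \<le> (\<Sum>j\<in>B. charge (x j))"
    "(16 * (\<Sum>j\<in>B. x j) - 8 * real k) / 15 \<le> (\<Sum>j\<in>B. charge (x j))"
proof
  define L where "L = {j \<in> B. 17/4 \<le> x j}"
  have L: "finite L" "L \<subseteq> B" using assms by (auto simp: L_def)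
  have "4 * real (card L) = (\<Sum>j\<in>L. 4)" by simp
  also have "\<dots> \<le> (\<Sum>j\<in>L. charge (x j))"
    by (rule sum_mono) (auto simp: charge_def L_def field_simps)
  also have "\<dots> \<le> (\<Sum>j\<in>B. charge (x j))"
    by (rule sum_mono2) (use assms L charge_nonneg in auto)
  finally show "4 * real (card L) \<le> (\<Sum>j\<in>B. charge (x j))" .
  have "real (card L) = (\<Sum>j\<in>B. if 17/4 \<le> x j then 1 else 0)"
    using assms(1) by (simp add: L_def sum.If_cases Int_def)
  then have "(16 * (\<Sum>j\<in>B. x j) - 8 * real (card L)) / 15 =
      (\<Sum>j\<in>B. (16 * x j - 8 * (if 17/4 \<le> x j then 1 else 0)) / 15)"
    by (simp only: sum_divide_distrib[symmetric] sum_subtractf sum_distrib_left)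
  also have "\<dots> \<le> (\<Sum>j\<in>B. charge (x j))"
    by (rule sum_mono) (auto simp: charge_def)
  finally show "(16 * (\<Sum>j\<in>B. x j) - 8 * real (card L)) / 15 \<le> (\<Sum>j\<in>B. charge (x j))" .
qed

text \<open>Two large items already cost 8; with at most one, the linear bound is (16 * 8 - 8) / 15
  = 8.\<close>

lemma sum_charge_ge_8:
  fixes x :: "'a \<Rightarrow> real"
  assumes "finite B" "\<And>j. j \<in> B \<Longrightarrow> 0 \<le> x j" "8 \<le> (\<Sum>j\<in>B. x j)"
  shows "8 \<le> (\<Sum>j\<in>B. charge (x j))"
proof -
  obtain k :: nat where k: "4 * real k \<le> (\<Sum>j\<in>B. charge (x j))"
    "(16 * (\<Sum>j\<in>B. x j) - 8 * real k) / 15 \<le> (\<Sum>j\<in>B. charge (x j))"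
    by (rule sum_charge_ge[OF assms(1), of x]) (use assms(2) in auto)
  have "real k \<le> 1 \<or> 2 \<le> real k" by (cases "k \<le> 1") simp_all
  then show ?thesis
  proof
    assume "real k \<le> 1"
    then have "8 \<le> (16 * (\<Sum>j\<in>B. x j) - 8 * real k) / 15"
      using assms(3) by (subst le_divide_eq) simp
    with k(2) show ?thesis by (rule order_trans[rotated])
  next
    assume "2 \<le> real k"
    with k(1) show ?thesis by linarith
  qed
qed

text \<open>The constant 19 is 30 - 11. Four large items already cost 16; with at most three, the
  linear bound is (16 * 19 - 24) / 15 > 16.\<close>

lemma sum_charge_ge_16:
  fixes x :: "'a \<Rightarrow> real"
  assumes "finite B" "\<And>j. j \<in> B \<Longrightarrow> 0 \<le> x j" "19 \<le> (\<Sum>j\<in>B. x j)"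
  shows "16 \<le> (\<Sum>j\<in>B. charge (x j))"
proof -
  obtain k :: nat where k: "4 * real k \<le> (\<Sum>j\<in>B. charge (x j))"
    "(16 * (\<Sum>j\<in>B. x j) - 8 * real k) / 15 \<le> (\<Sum>j\<in>B. charge (x j))"
    by (rule sum_charge_ge[OF assms(1), of x]) (use assms(2) in auto)
  have "real k \<le> 3 \<or> 4 \<le> real k" by (cases "k \<le> 3") simp_all
  then show ?thesis
  proof
    assume "real k \<le> 3"
    then have "16 \<le> (16 * (\<Sum>j\<in>B. x j) - 8 * real k) / 15"
      using assms(3) by (subst le_divide_eq) simp
    with k(2) show ?thesis by (rule order_trans[rotated])
  next
    assume "4 \<le> real k"
    with k(1) show ?thesis by linarith
  qed
qed

text \<open>If all three items are large, adding the inequalities bounds their sum by 33/2, and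
  three rebates bring the cost down to 16. Otherwise one item is below 17/4 and the sum is below
  61/4; one rebate then suffices, and without any large item the sum is below 51/4.\<close>

lemma sum_charge_triple_le:
  assumes "0 \<le> a" "0 \<le> b" "0 \<le> c" "a + b < 11" "b + c < 11" "a + c < 11"
  shows "charge a + charge b + charge c \<le> 16"
  using assms unfolding charge_def by (auto simp: field_simps)

lemma sum_charge_bundle_le:
  fixes x :: "'a \<Rightarrow> real"
  assumes "3 \<le> card A" "\<And>j. j \<in> A \<Longrightarrow> 0 \<le> x j" "\<And>j. j \<in> A \<Longrightarrow> (\<Sum>k\<in>A - {j}. x k) < 11"
  shows "(\<Sum>j\<in>A. charge (x j)) \<le> 16"
proof (cases "card A = 3")
  case True
  then obtain a b c where A: "A = {a, b, c}" "a \<noteq> b" "b \<noteq> c" "a \<noteq> c"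
    by (auto simp: card_3_iff)
  have "A - {c} = {a, b}" "A - {a} = {b, c}" "A - {b} = {a, c}" using A by auto
  then have "x a + x b < 11" "x b + x c < 11" "x a + x c < 11"
    using A assms(3)[of a] assms(3)[of b] assms(3)[of c] by auto
  then show ?thesis using A assms(2) sum_charge_triple_le[of "x a" "x b" "x c"] by simp
next
  case False
  define s where "s = real (card A)"
  define X where "X = (\<Sum>j\<in>A. x j)"
  have s: "4 \<le> s" using False assms(1) by (auto simp: s_def)
  have fin: "finite A" using assms(1) by (auto intro: card_ge_0_finite)
  \<comment> \<open>Summing the hypothesis over all \<open>j\<close> counts each item
    \<open>s - 1\<close> times. For \<open>s >= 4\<close> this yields \<open>X <= 44 / 3\<close>,
    and 16/15 * 44/3 = 704/45 is below 16 even without rebates.\<close>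
  have "s * X - X = (\<Sum>j\<in>A. X - x j)" by (simp add: s_def X_def sum_subtractf)
  also have "\<dots> = (\<Sum>j\<in>A. \<Sum>k\<in>A - {j}. x k)"
    by (rule sum.cong) (use fin in \<open>auto simp: X_def sum.remove\<close>)
  also have "\<dots> \<le> (\<Sum>j\<in>A. 11)"
    by (rule sum_mono) (use assms(3) in \<open>auto intro: less_imp_le\<close>)
  finally have 1: "(s - 1) * X \<le> 11 * s" by (simp add: s_def algebra_simps)
  have "11 * s \<le> (s - 1) * (44 / 3)" using s by (simp add: field_simps)
  with 1 have "(s - 1) * X \<le> (s - 1) * (44 / 3)" by linarith
  then have "X \<le> 44 / 3" using s by (subst (asm) mult_le_cancel_left_pos) auto
  moreover have "(\<Sum>j\<in>A. charge (x j)) \<le> (\<Sum>j\<in>A. 16 / 15 * x j)"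
    by (rule sum_mono) (rule charge_le)
  moreover have "(\<Sum>j\<in>A. 16 / 15 * x j) = 16 / 15 * X"
    unfolding X_def by (rule sum_distrib_left[symmetric])
  ultimately show ?thesis by simp
qed

text \<open>
  The set \<open>A k\<close> is the bundle taken by agent \<open>k\<close>, and \<open>w\<close>, \<open>t\<close> are the values and the threshold
  of an agent \<open>i\<close> that has received nothing.
\<close>

lemma mms_less_if_unsatisfied:
  fixes A :: "nat \<Rightarrow> 'a set" and w :: "'a \<Rightarrow> real"
  assumes H: "hereditary_system J F" and w: "\<And>j. j \<in> J \<Longrightarrow> 0 \<le> w j"
    and D: "D \<subseteq> {..<n}" "i < n" "i \<notin> D"
    and A: "\<And>k. k \<in> D \<Longrightarrow> A k \<in> F" "disjoint_family_on A D"
      "\<And>k j. k \<in> D \<Longrightarrow> j \<in> A k \<Longrightarrow> valuation F w (A k - {j}) < t"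
    and R: "valuation F w (J - (\<Union>k\<in>D. A k)) < t"
  shows "11 / 30 * mms J n (valuation F w) < t"
proof (rule ccontr)
  assume "\<not> ?thesis"
  then have le: "t \<le> 11 / 30 * mms J n (valuation F w)" by simp
  have FJ: "finite J" "F \<subseteq> Pow J" and sub: "\<And>S T. S \<in> F \<Longrightarrow> T \<subseteq> S \<Longrightarrow> T \<in> F" and "F \<noteq> {}"
    using H unfolding hereditary_system_def by auto
  have F: "finite F" using FJ finite_subset by auto
  have F0: "{} \<in> F" using sub \<open>F \<noteq> {}\<close> by blast
  have t: "0 < t" using valuation_nonneg[OF F F0] R by (rule le_less_trans)
  have n: "0 < n" using D(2) by simp
  have finD: "finite D" using D(1) finite_subset by auto
  obtain P where P: "disjoint_family_on P {..<n}" "(\<Union>k<n. P k) = J"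
    "\<And>k. k < n \<Longrightarrow> mms J n (valuation F w) \<le> valuation F w (P k)"
    using mms_attained[OF FJ(1) n] by metis
  have "\<exists>T. T \<in> F \<and> T \<subseteq> P k \<and> valuation F w (P k) = (\<Sum>j\<in>T. w j)" for k
    using valuation_attained[OF F F0] by metis
  then obtain T where T: "\<And>k. T k \<in> F" "\<And>k. T k \<subseteq> P k"
    "\<And>k. valuation F w (P k) = (\<Sum>j\<in>T k. w j)" by metis
  define x where "x j = 11 / t * w j" for j
  have sx: "(\<Sum>j\<in>S. x j) = 11 / t * (\<Sum>j\<in>S. w j)" for S
    by (simp add: x_def sum_distrib_left)
  have x0: "0 \<le> x j" if "j \<in> J" for j using w[OF that] t by (simp add: x_def)
  have small: "(\<Sum>j\<in>S. x j) < 11" if "S \<in> F" "S \<subseteq> S'" "valuation F w S' < t" for S S'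
    using sum_le_valuation[OF F that(1,2), of w] that(3) t by (simp add: sx field_simps)
  define U where "U = (\<Union>k\<in>D. A k)"
  have finF: "finite S" if "S \<in> F" for S using that FJ finite_subset by blast
  have finU: "finite U" using finD A(1) finF by (auto simp: U_def)
  have UJ: "U \<subseteq> J" using A(1) FJ(2) by (auto simp: U_def)
  have "\<exists>f. \<forall>k\<in>D. \<forall>j\<in>A k. f j = k"
  proof -
    have "\<forall>j\<in>U. \<exists>k. k \<in> D \<and> j \<in> A k" by (auto simp: U_def)
    then obtain f where "\<forall>j\<in>U. f j \<in> D \<and> j \<in> A (f j)" by metis
    then have "\<forall>k\<in>D. \<forall>j\<in>A k. f j = k"
      using A(2) by (fastforce simp: disjoint_family_on_def U_def)
    then show ?thesis by blast
  qed
  then obtain f where f: "\<And>k j. k \<in> D \<Longrightarrow> j \<in> A k \<Longrightarrow> f j = k" by blast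
  \<comment> \<open>Here \<open>f j\<close> is the recipient of item \<open>j\<close>. Small bundles
    need flat rates: the item of a singleton bundle has no bound on its value, and two items worth
    almost 11 each would cost more than 16 under \<open>charge\<close>.\<close>
  define c where "c j = (if card (A (f j)) = 1 then 16 else if card (A (f j)) = 2 then 8
    else charge (x j))" for j
  have c0: "0 \<le> c j" if "j \<in> J" for j using charge_nonneg[OF x0[OF that]] by (simp add: c_def)
  have taken: "(\<Sum>j\<in>A k. c j) \<le> 16" if k: "k \<in> D" for k
  proof -
    have AF: "A k \<in> F" using A(1) k .
    have "(\<Sum>j\<in>A k. c j) = (\<Sum>j\<in>A k. if card (A k) = 1 then 16 else
        if card (A k) = 2 then 8 else charge (x j))"
      by (rule sum.cong) (use f k in \<open>auto simp: c_def\<close>)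
    moreover have "(\<Sum>j\<in>A k. charge (x j)) \<le> 16" if "3 \<le> card (A k)"
    proof (rule sum_charge_bundle_le[OF that])
      show "0 \<le> x j" if "j \<in> A k" for j using that AF FJ x0 by blast
      show "(\<Sum>l\<in>A k - {j}. x l) < 11" if "j \<in> A k" for j
        by (rule small[OF sub[OF AF] order_refl A(3)[OF k that]]) auto
    qed
    moreover have "A k = {}" if "card (A k) = 0" using that finF[OF AF] by simp
    ultimately show ?thesis
      by (cases "card (A k) = 0"; cases "card (A k) = 1"; cases "card (A k) = 2") auto
  qed
  \<comment> \<open>The feasible set \<open>T k\<close> has scaled value at least 30, and its free
    items form a feasible set worth less than 11, so more than 19 was lost.\<close>
  have charged: "16 \<le> (\<Sum>j\<in>T k \<inter> U. c j)" if k: "k < n" for k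
  proof -
    let ?B = "T k \<inter> U"
    have fin: "finite ?B" using finU by simp
    have BJ: "j \<in> J" if "j \<in> ?B" for j using that UJ by auto
    have "30 \<le> (\<Sum>j\<in>T k. x j)"
      using P(3)[OF k] le t by (simp add: sx T(3)[symmetric] field_simps)
    moreover have "(\<Sum>j\<in>T k - U. x j) < 11"
      by (rule small[OF sub[OF T(1)[of k]] _ R]) (use T(1)[of k] FJ(2) in \<open>auto simp: U_def\<close>)
    moreover have "(\<Sum>j\<in>T k. x j) = (\<Sum>j\<in>T k - U. x j) + (\<Sum>j\<in>?B. x j)"
      using sum.Int_Diff[OF finF[OF T(1)[of k]], of x U] by simp
    ultimately have B19: "19 < (\<Sum>j\<in>?B. x j)" by linarith
    have mono: "(\<Sum>j\<in>C. c j) \<le> (\<Sum>j\<in>?B. c j)" if "C \<subseteq> ?B" for C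
      by (rule sum_mono2) (use fin that c0 BJ in auto)
    \<comment> \<open>The items lost in pairs pay 8 each. Two of them suffice; with one the
      remaining lost items must pay 8, with none they must pay 16.\<close>
    define E where "E = {j \<in> ?B. card (A (f j)) = 2}"
    have "E \<subseteq> ?B" by (auto simp: E_def)
    then have finE: "finite E" using fin by (rule finite_subset)
    show ?thesis
    proof (cases "\<exists>j\<in>?B. card (A (f j)) = 1")
      case True
      then obtain j where "j \<in> ?B" "card (A (f j)) = 1" by blast
      then show ?thesis using mono[of "{j}"] by (simp add: c_def)
    next
      case no1: False
      have rest: "(\<Sum>j\<in>?B - E. c j) = (\<Sum>j\<in>?B - E. charge (x j))"
        by (rule sum.cong) (use no1 in \<open>auto simp: c_def E_def\<close>)
      have splitx: "(\<Sum>j\<in>?B. x j) = (\<Sum>j\<in>?B - E. x j) + (\<Sum>j\<in>E. x j)"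
        and splitc: "(\<Sum>j\<in>?B. c j) = (\<Sum>j\<in>?B - E. c j) + (\<Sum>j\<in>E. c j)"
        using sum.subset_diff[OF \<open>E \<subseteq> ?B\<close> fin] by auto
      have cE: "(\<Sum>j\<in>E. c j) = 8 * real (card E)" by (simp add: c_def E_def)
      have nn: "0 \<le> x j" if "j \<in> ?B - E" for j using that BJ x0 by blast
      have fin': "finite (?B - E)" using fin by simp
      consider "card E = 0" | "card E = 1" | "2 \<le> card E" by linarith
      then show ?thesis
      proof cases
        case 1
        then have "E = {}" using finE by simp
        then have "19 \<le> (\<Sum>j\<in>?B - E. x j)" using B19 by simp
        from sum_charge_ge_16[of _ x, OF fin' nn this] show ?thesis
          using rest splitc cE 1 by linarith
      next
        case 2
        then obtain e where e: "E = {e}" by (rule card_1_singletonE)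
        then have "e \<in> U" "card (A (f e)) = 2" by (auto simp: E_def)
        then obtain k' where k': "k' \<in> D" "e \<in> A k'" "card (A k') = 2"
          using f by (auto simp: U_def)
        then obtain a b where "A k' = {a, b}" "a \<noteq> b" by (auto simp: card_2_iff)
        then obtain e' where "A k' = {e, e'}" "e \<noteq> e'"
          using \<open>e \<in> A k'\<close> by (cases "e = a") blast+
        \<comment> \<open>Dropping the partner \<open>e'\<close> leaves \<open>{e}\<close>, so
          \<open>e\<close> is worth less than 11 and the other lost items more than 19 - 11 =
          8.\<close>
        then have "A k' - {e'} = {e}" by auto
        then have "(\<Sum>j\<in>{e}. x j) < 11"
          using A(3)[OF k'(1), of e'] \<open>A k' = {e, e'}\<close> small[of "{e}" "{e}"]
            sub[OF A(1)[OF k'(1)], of "{e}"] by simp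
        then have "(\<Sum>j\<in>E. x j) < 11" using e by simp
        then have "8 \<le> (\<Sum>j\<in>?B - E. x j)" using splitx B19 by linarith
        from sum_charge_ge_8[of _ x, OF fin' nn this] show ?thesis
          using rest splitc cE 2 by linarith
      next
        case 3
        have "0 \<le> (\<Sum>j\<in>?B - E. c j)" by (rule sum_nonneg) (use BJ c0 in auto)
        then show ?thesis using splitc cE 3 by linarith
      qed
    qed
  qed
  have disjT: "T k \<inter> U \<inter> (T l \<inter> U) = {}" if "k < n" "l < n" "k \<noteq> l" for k l
    using P(1) T(2)[of k] T(2)[of l] that by (fastforce simp: disjoint_family_on_def)
  \<comment> \<open>Double counting: the \<open>n\<close> disjoint parts collect at least 16 each,
    the bundles pay at most 16 each, and as \<open>i\<close> is not in \<open>D\<close> there are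
    fewer than \<open>n\<close> bundles.\<close>
  have "16 * real n = (\<Sum>k<n. 16)" by simp
  also have "\<dots> \<le> (\<Sum>k<n. \<Sum>j\<in>T k \<inter> U. c j)" by (rule sum_mono) (use charged in simp)
  also have "\<dots> = (\<Sum>j\<in>(\<Union>k<n. T k \<inter> U). c j)"
    by (rule sum.UNION_disjoint[symmetric]) (use finU disjT in auto)
  also have "\<dots> \<le> (\<Sum>j\<in>U. c j)"
    by (rule sum_mono2) (use finU UJ c0 in auto)
  also have "\<dots> = (\<Sum>k\<in>D. \<Sum>j\<in>A k. c j)"
    unfolding U_def
    by (rule sum.UNION_disjoint) (use finD A(1,2) finF in \<open>auto simp: disjoint_family_on_def\<close>)
  also have "\<dots> \<le> (\<Sum>k\<in>D. 16)" by (rule sum_mono) (use taken in simp)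
  finally have "n \<le> card D" by simp
  moreover have "card D < n" using psubset_card_mono[of "{..<n}" D] D by force
  ultimately show False by simp
qed

section \<open>A program logic with running times\<close>

text \<open>Total correctness with step budget \<open>T\<close>: a halting run exists, and by
  determinism it is the only one. Queries get no budget of their own, since
  \<open>queries_le_steps\<close> bounds them.\<close>

definition runs ::
  "(nat \<Rightarrow> nat set \<Rightarrow> real) \<Rightarrow> com \<Rightarrow> state \<Rightarrow> nat \<Rightarrow> (state \<Rightarrow> bool) \<Rightarrow> bool" where
  "runs orc c s T Q \<longleftrightarrow> (\<exists>q t s'. exec orc c s q t s' \<and> t \<le> T \<and> Q s')"

lemma runs_mono:
  "runs orc c s T Q \<Longrightarrow> T \<le> T' \<Longrightarrow> (\<And>s'. Q s' \<Longrightarrow> Q' s') \<Longrightarrow> runs orc c s T' Q'"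
  unfolding runs_def by (meson order_trans)

lemma queries_le_steps: "exec orc c s q t s' \<Longrightarrow> q \<le> t"
  by (induction rule: exec.induct) auto

lemma runs_Skip [simp]: "runs orc Skip s T Q \<longleftrightarrow> 1 \<le> T \<and> Q s"
  unfolding runs_def by (blast elim: exec.cases intro: exec.intros)

lemma runs_NAssign [simp]:
  "runs orc (NAssign x a e) s T Q \<longleftrightarrow> 1 \<le> T \<and> Q (nwrite x (nval a s) (nval e s) s)"
  unfolding runs_def by (blast elim: exec.cases intro: exec.intros)

lemma runs_RAssign [simp]:
  "runs orc (RAssign x a e) s T Q \<longleftrightarrow> 1 \<le> T \<and> Q (rwrite x (nval a s) (rval e s) s)"
  unfolding runs_def by (blast elim: exec.cases intro: exec.intros)

lemma runs_Query [simp]: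
  "runs orc (Query x a i y) s T Q \<longleftrightarrow>
     1 \<le> T \<and> Q (rwrite x (nval a s) (orc (nval i s) {j. nats s y j \<noteq> 0}) s)"
  unfolding runs_def by (blast elim: exec.cases intro: exec.intros)

lemma runs_Cond:
  assumes "1 \<le> T" "bval b s \<Longrightarrow> runs orc c1 s (T - 1) Q" "\<not> bval b s \<Longrightarrow> runs orc c2 s (T - 1) Q"
  shows "runs orc (Cond b c1 c2) s T Q"
proof -
  obtain q t s' where 1: "exec orc (if bval b s then c1 else c2) s q t s'" "t \<le> T - 1" "Q s'"
    using assms(2,3) unfolding runs_def by (cases "bval b s") auto
  have "exec orc (Cond b c1 c2) s q (t + 1) s'"
    using 1(1) exec.CondTrue exec.CondFalse by (cases "bval b s") auto
  moreover have "t + 1 \<le> T" using 1(2) assms(1) by simp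
  ultimately show ?thesis unfolding runs_def using 1(3) by blast
qed

lemma runs_Seq:
  assumes "runs orc c1 s T1 (\<lambda>s1. runs orc c2 s1 T2 Q)"
  shows "runs orc (Seq c1 c2) s (T1 + T2) Q"
proof -
  obtain q1 t1 s1 q2 t2 s2 where
    "exec orc c1 s q1 t1 s1" "t1 \<le> T1" "exec orc c2 s1 q2 t2 s2" "t2 \<le> T2" "Q s2"
    using assms unfolding runs_def by blast
  then show ?thesis unfolding runs_def by (meson exec.Seq add_mono)
qed

lemma runs_Seq_step:
  assumes "1 \<le> T" "runs orc c1 s 1 (\<lambda>s1. runs orc c2 s1 (T - 1) Q)"
  shows "runs orc (Seq c1 c2) s T Q"
  using runs_Seq[OF assms(2)] assms(1) by simp

lemma runs_Seq_NAssign: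
  "1 \<le> T \<Longrightarrow> runs orc c (nwrite x (nval a s) (nval e s) s) (T - 1) Q \<Longrightarrow>
     runs orc (Seq (NAssign x a e) c) s T Q"
  by (rule runs_Seq_step) simp_all

lemma runs_Seq_RAssign:
  "1 \<le> T \<Longrightarrow> runs orc c (rwrite x (nval a s) (rval e s) s) (T - 1) Q \<Longrightarrow>
     runs orc (Seq (RAssign x a e) c) s T Q"
  by (rule runs_Seq_step) simp_all

lemma runs_Seq_Query:
  "1 \<le> T \<Longrightarrow> runs orc c (rwrite x (nval a s) (orc (nval i s) {j. nats s y j \<noteq> 0}) s) (T - 1) Q \<Longrightarrow>
     runs orc (Seq (Query x a i y) c) s T Q"
  by (rule runs_Seq_step) simp_all

lemmas runs_intros = runs_Cond runs_Seq_NAssign runs_Seq_RAssign runs_Seq_Query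

lemma runs_Seq_bound:
  assumes "runs orc c1 s T1 P" "\<And>s1. P s1 \<Longrightarrow> runs orc c2 s1 T2 Q" "T1 + T2 \<le> T"
  shows "runs orc (Seq c1 c2) s T Q"
proof -
  have "runs orc c1 s T1 (\<lambda>s1. runs orc c2 s1 T2 Q)"
    by (rule runs_mono[OF assms(1)]) (use assms(2) in auto)
  from runs_Seq[OF this] show ?thesis by (rule runs_mono) (use assms(3) in auto)
qed

section \<open>Frame conditions and rules for loops\<close>

fun nwritten :: "com \<Rightarrow> string set" where
  "nwritten (NAssign x a e) = {x}"
| "nwritten (Seq c1 c2) = nwritten c1 \<union> nwritten c2"
| "nwritten (Cond b c1 c2) = nwritten c1 \<union> nwritten c2"
| "nwritten (While b c) = nwritten c"
| "nwritten _ = {}"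

fun rwritten :: "com \<Rightarrow> string set" where
  "rwritten (RAssign x a e) = {x}"
| "rwritten (Query x a i y) = {x}"
| "rwritten (Seq c1 c2) = rwritten c1 \<union> rwritten c2"
| "rwritten (Cond b c1 c2) = rwritten c1 \<union> rwritten c2"
| "rwritten (While b c) = rwritten c"
| "rwritten _ = {}"

text \<open>Arrays are tracked by name and as wholes. Loop invariants can then be restricted to the
  arrays that matter, and the rest is recovered from the frame.\<close>

definition frame :: "com \<Rightarrow> state \<Rightarrow> state \<Rightarrow> bool" where
  "frame c s s' \<longleftrightarrow> (\<forall>x. x \<notin> nwritten c \<longrightarrow> nats s' x = nats s x) \<and>
     (\<forall>x. x \<notin> rwritten c \<longrightarrow> reals s' x = reals s x)"

lemma frame_nats: "frame c s s' \<Longrightarrow> x \<notin> nwritten c \<Longrightarrow> nats s' x = nats s x"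
  and frame_reals: "frame c s s' \<Longrightarrow> x \<notin> rwritten c \<Longrightarrow> reals s' x = reals s x"
  by (auto simp: frame_def)

lemma nats_nwrite [simp]:
  "nats (nwrite x k a s) y = (if y = x then (nats s x)(k := a) else nats s y)"
  by (auto simp: nwrite_def)

lemma reals_nwrite [simp]: "reals (nwrite x k a s) = reals s"
  by (simp add: nwrite_def)

lemma reals_rwrite [simp]:
  "reals (rwrite x k r s) y = (if y = x then (reals s x)(k := r) else reals s y)"
  by (auto simp: rwrite_def)

lemma nats_rwrite [simp]: "nats (rwrite x k r s) = nats s"
  by (simp add: rwrite_def)

lemma exec_frame: "exec orc c s q t s' \<Longrightarrow> frame c s s'"
  by (induction rule: exec.induct) (auto simp: frame_def)

lemma runs_frame: "runs orc c s T Q \<Longrightarrow> runs orc c s T (\<lambda>s'. Q s' \<and> frame c s s')"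
  unfolding runs_def using exec_frame by blast

text \<open>The index \<open>r\<close> counts completed iterations. Each costs one test besides the
  body, and one failing test ends the loop. The frame relates every iteration to the start state, so
  facts about unwritten arrays need not be put into \<open>I\<close>.\<close>

lemma runs_While:
  assumes "I 0 s"
    and "\<And>r s'. I r s' \<Longrightarrow> bval b s' \<Longrightarrow> frame c s s' \<Longrightarrow> r < N \<and> runs orc c s' T (I (Suc r))"
  shows "runs orc (While b c) s (N * (T + 1) + 1)
    (\<lambda>s'. (\<exists>r. I r s') \<and> \<not> bval b s' \<and> frame c s s')"
proof -
  have "runs orc (While b c) s1 ((N - r) * (T + 1) + 1)
      (\<lambda>s'. (\<exists>r. I r s') \<and> \<not> bval b s' \<and> frame c s s')"
    if "I r s1" "frame c s s1" for r s1
    using that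
  proof (induction "N - r" arbitrary: r s1 rule: less_induct)
    case less
    show ?case
    proof (cases "bval b s1")
      case False
      then have "exec orc (While b c) s1 0 1 s1" by (rule exec.WhileFalse)
      then show ?thesis unfolding runs_def using less.prems False by fastforce
    next
      case True
      have r: "r < N" and "runs orc c s1 T (I (Suc r))"
        using assms(2)[OF less.prems(1) True less.prems(2)] by auto
      then obtain q1 t1 s2 where 1: "exec orc c s1 q1 t1 s2" "t1 \<le> T" "I (Suc r) s2"
        unfolding runs_def by blast
      have "frame c s s2"
        using less.prems(2) exec_frame[OF 1(1)] by (auto simp: frame_def)
      then have "runs orc (While b c) s2 ((N - Suc r) * (T + 1) + 1)
          (\<lambda>s'. (\<exists>r. I r s') \<and> \<not> bval b s' \<and> frame c s s')"
        using less.hyps[of "Suc r" s2] 1(3) r by simp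
      then obtain q2 t2 s3 where 2: "exec orc (While b c) s2 q2 t2 s3"
        "t2 \<le> (N - Suc r) * (T + 1) + 1" "(\<exists>r. I r s3) \<and> \<not> bval b s3 \<and> frame c s s3"
        unfolding runs_def by blast
      have "N - r = Suc (N - Suc r)" using r by simp
      then have "t1 + t2 + 1 \<le> (N - r) * (T + 1) + 1" using 1(2) 2(2) by simp
      then show ?thesis
        unfolding runs_def using exec.WhileTrue[OF True 1(1) 2(1)] 2(3) by blast
    qed
  qed
  from this[OF assms(1)] show ?thesis by (simp add: frame_def)
qed

abbreviation V :: "string \<Rightarrow> nexp" where
  "V x \<equiv> NElem x (NConst 0)"

definition loop :: "string \<Rightarrow> string \<Rightarrow> com \<Rightarrow> com" where
  "loop x b c = Seq (NAssign x (NConst 0) (NConst 0))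
     (While (NLess (V x) (V b)) (Seq c (NAssign x (NConst 0) (NPlus (V x) (NConst 1)))))"

lemma nwritten_loop [simp]: "nwritten (loop x b c) = insert x (nwritten c)"
  and rwritten_loop [simp]: "rwritten (loop x b c) = rwritten c"
  by (auto simp: loop_def)

text \<open>Costs are monomials in a single size parameter \<open>X\<close>, so nesting a loop
  raises the exponent by one. Hypothesis \<open>ctr\<close> makes the invariant independent of the
  counter, so resetting and incrementing it preserve \<open>I\<close>.\<close>

lemma runs_loop:
  assumes b: "nats s b 0 = N" "N \<le> X" "1 \<le> X" "x \<noteq> b" "b \<notin> nwritten c" "x \<notin> nwritten c"
    and I0: "I 0 s"
    and ctr: "\<And>k l s'. I k (nwrite x 0 l s') \<longleftrightarrow> I k s'"
    and step: "\<And>k s'. k < N \<Longrightarrow> I k s' \<Longrightarrow> nats s' x 0 = k \<Longrightarrow> frame (loop x b c) s s' \<Longrightarrow>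
      runs orc c s' (C * X ^ p) (I (Suc k))"
  shows "runs orc (loop x b c) s ((C + 4) * X ^ Suc p) (\<lambda>s'. I N s' \<and> frame (loop x b c) s s')"
proof -
  define T where "T = C * X ^ p"
  define J where "J k s' \<longleftrightarrow> I k s' \<and> nats s' x 0 = k \<and> k \<le> N" for k s'
  let ?c = "Seq c (NAssign x (NConst 0) (NPlus (V x) (NConst 1)))"
  let ?s = "nwrite x 0 0 s"
  have "runs orc (While (NLess (V x) (V b)) ?c) ?s (N * (T + 1 + 1) + 1)
      (\<lambda>s'. (\<exists>r. J r s') \<and> \<not> bval (NLess (V x) (V b)) s' \<and> frame ?c ?s s')"
  proof (rule runs_While)
    show "J 0 ?s" by (simp add: J_def ctr I0)
  next
    fix r s' assume J: "J r s'" and lt: "bval (NLess (V x) (V b)) s'" and fr: "frame ?c ?s s'"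
    have "nats s' b = nats s b" using frame_nats[OF fr, of b] b by simp
    then have r: "r < N" using lt J b(1) by (simp add: J_def)
    have "frame (loop x b c) s s'" using fr by (auto simp: frame_def)
    then have "runs orc c s' T (I (Suc r))"
      using step[of r s'] J r by (simp add: J_def T_def)
    then have "runs orc c s' T (\<lambda>s''. I (Suc r) s'' \<and> frame c s' s'')" by (rule runs_frame)
    then have "runs orc c s' T (\<lambda>s''. runs orc
        (NAssign x (NConst 0) (NPlus (V x) (NConst 1))) s'' 1 (J (Suc r)))"
      by (rule runs_mono) (use J r b(6) in \<open>auto simp: J_def ctr frame_def\<close>)
    then show "r < N \<and> runs orc ?c s' (T + 1) (J (Suc r))" using r runs_Seq by blast
  qed
  then have "runs orc (While (NLess (V x) (V b)) ?c) ?s (N * (T + 1 + 1) + 1) (I N)"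
  proof (rule runs_mono)
    fix s' assume *: "(\<exists>r. J r s') \<and> \<not> bval (NLess (V x) (V b)) s' \<and> frame ?c ?s s'"
    then have "nats s' b = nats s b" using frame_nats[of ?c ?s s' b] b by simp
    then show "I N s'" using * b(1) by (auto simp: J_def)
  qed simp
  then have "runs orc (loop x b c) s (1 + (N * (T + 1 + 1) + 1)) (I N)"
    unfolding loop_def by (intro runs_Seq) simp
  \<comment> \<open>The test and the increment make an iteration cost \<open>T + 2\<close>; the
    initial assignment and the last test add 2. The constant 4 absorbs
    \<open>2 * X + 2\<close>.\<close>
  moreover have "1 + (N * (T + 1 + 1) + 1) \<le> (C + 4) * X ^ Suc p"
  proof -
    have "N * (T + 2) \<le> X * (T + 2)" using b(2) by (rule mult_le_mono1)
    moreover have "X * (T + 2) = C * X ^ Suc p + 2 * X" by (simp add: T_def algebra_simps)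
    moreover have "X * 1 \<le> X * X ^ p" by (rule mult_le_mono2) (use b(3) in simp)
    then have "X \<le> X ^ Suc p" by simp
    moreover have "1 + (N * (T + 1 + 1) + 1) = N * (T + 2) + 2" by simp
    moreover have "(C + 4) * X ^ Suc p = C * X ^ Suc p + 4 * X ^ Suc p"
      by (rule add_mult_distrib)
    ultimately show ?thesis using b(3) by linarith
  qed
  ultimately have "runs orc (loop x b c) s ((C + 4) * X ^ Suc p) (I N)"
    by (rule runs_mono)
  then show ?thesis by (rule runs_frame)
qed

section \<open>The program\<close>

text \<open>
  Array \<open>h\<close> holds the thresholds and \<open>b\<close> the values of the single items for one agent. An agent is
  waiting while its entry in \<open>d\<close> is 0, and an item is free while its \<open>owner\<close> is \<open>n\<close>. The array
  \<open>S\<close> is the set being shrunk, and \<open>w\<close> is a waiting agent for whom its value reaches the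
  threshold, or \<open>n\<close> if there is none. The flag \<open>g\<close> is set if some threshold was lowered.
\<close>

definition scan_agents :: com where
  "scan_agents = Seq (NAssign ''w'' (NConst 0) (V ''n''))
    (loop ''i'' ''n'' (Cond (NLess (NElem ''d'' (V ''i'')) (NConst 1))
      (Seq (Query ''r'' (NConst 0) (V ''i'') ''S'')
        (Cond (RLess (RElem ''r'' (NConst 0)) (RElem ''h'' (V ''i''))) Skip
          (NAssign ''w'' (NConst 0) (V ''i''))))
      Skip))"

definition shrink :: com where
  "shrink = loop ''k'' ''m'' (Cond (NLess (NElem ''S'' (V ''k'')) (NConst 1)) Skip
    (Seq (NAssign ''S'' (V ''k'') (NConst 0))
      (Seq scan_agents
        (Cond (NLess (V ''w'') (V ''n'')) Skip (NAssign ''S'' (V ''k'') (NConst 1))))))"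

definition collect_free :: com where
  "collect_free = loop ''j'' ''m'' (Cond (NLess (NElem ''owner'' (V ''j'')) (V ''n''))
    (NAssign ''S'' (V ''j'') (NConst 0)) (NAssign ''S'' (V ''j'') (NConst 1)))"

definition give :: com where
  "give = Seq scan_agents (Cond (NLess (V ''w'') (V ''n''))
    (Seq (NAssign ''d'' (V ''w'') (NConst 1))
      (loop ''j'' ''m'' (Cond (NLess (NElem ''S'' (V ''j'')) (NConst 1)) Skip
        (NAssign ''owner'' (V ''j'') (V ''w'')))))
    Skip)"

definition step :: com where
  "step = Seq collect_free (Seq shrink give)"

definition lower :: "nat \<Rightarrow> com" where
  "lower K = loop ''i'' ''n'' (Cond (NLess (NElem ''d'' (V ''i'')) (NConst 1))
        (Seq (RAssign ''h'' (V ''i'')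
            (RScale (of_nat K / (of_nat K + 1)) (RElem ''h'' (V ''i''))))
          (NAssign ''g'' (NConst 0) (NConst 1)))
        Skip)"

definition allocation_round :: "nat \<Rightarrow> com" where
  "allocation_round K = Seq (NAssign ''g'' (NConst 0) (NConst 0))
    (Seq (loop ''j'' ''m'' (NAssign ''owner'' (V ''j'') (V ''n'')))
    (Seq (loop ''i'' ''n'' (NAssign ''d'' (V ''i'') (NConst 0)))
    (Seq (loop ''a'' ''n'' step) (lower K))))"

definition query_singletons :: com where
  "query_singletons = loop ''j'' ''m'' (Seq (NAssign ''y'' (V ''j'') (NConst 1))
        (Seq (Query ''b'' (V ''j'') (V ''a'') ''y'') (NAssign ''y'' (V ''j'') (NConst 0))))"

definition sum_frequent :: com where
  "sum_frequent = loop ''j'' ''m'' (Seq (NAssign ''c'' (NConst 0) (NConst 0))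
        (Seq (loop ''k'' ''m'' (Cond (RLess (RElem ''b'' (V ''k'')) (RElem ''b'' (V ''j''))) Skip
            (NAssign ''c'' (NConst 0) (NPlus (V ''c'') (NConst 1)))))
          (Cond (NLess (V ''c'') (V ''n'')) Skip
            (RAssign ''h'' (V ''a'') (RPlus (RElem ''h'' (V ''a''))
              (RScale (11 / 30) (RElem ''b'' (V ''j''))))))))"

definition initialise :: com where
  "initialise = loop ''a'' ''n'' (Seq query_singletons sum_frequent)"

text \<open>The flag \<open>g\<close> is set beforehand so that at least one round takes
  place.\<close>

definition main :: "nat \<Rightarrow> com" where
  "main K = Seq initialise (Seq (NAssign ''g'' (NConst 0) (NConst 1))
    (While (NLess (NConst 0) (V ''g'')) (allocation_round K)))"

definition members :: "state \<Rightarrow> nat set" where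
  "members s = {j. nats s ''S'' j \<noteq> 0}"

definition waiting :: "nat \<Rightarrow> state \<Rightarrow> nat set" where
  "waiting n s = {i. i < n \<and> nats s ''d'' i = 0}"

lemma runs_scan_agents:
  assumes "nats s ''n'' 0 = n" "n \<le> X" "1 \<le> X"
  shows "runs orc scan_agents s (10 * X) (\<lambda>s'. frame scan_agents s s' \<and>
    (if nats s' ''w'' 0 < n
     then nats s' ''w'' 0 \<in> waiting n s \<and>
       reals s ''h'' (nats s' ''w'' 0) \<le> orc (nats s' ''w'' 0) (members s)
     else \<forall>i\<in>waiting n s. orc i (members s) < reals s ''h'' i))"
    (is "runs _ _ _ _ (\<lambda>s'. _ \<and> ?Q s')")
proof -
  let ?c = "Cond (NLess (NElem ''d'' (V ''i'')) (NConst 1))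
      (Seq (Query ''r'' (NConst 0) (V ''i'') ''S'')
        (Cond (RLess (RElem ''r'' (NConst 0)) (RElem ''h'' (V ''i''))) Skip
          (NAssign ''w'' (NConst 0) (V ''i''))))
      Skip"
  \<comment> \<open>While \<open>w\<close> is still \<open>n\<close>, all waiting agents scanned so
    far have failed; once \<open>w\<close> holds an agent, the scan only needs to keep it
    valid.\<close>
  define I where "I k s' \<longleftrightarrow> (if nats s' ''w'' 0 < n
     then nats s' ''w'' 0 \<in> waiting n s \<and>
       reals s ''h'' (nats s' ''w'' 0) \<le> orc (nats s' ''w'' 0) (members s)
     else \<forall>i\<in>waiting n s. i < k \<longrightarrow> orc i (members s) < reals s ''h'' i)" for k :: nat and s' :: state
  let ?s = "nwrite ''w'' 0 n s"
  have "runs orc (loop ''i'' ''n'' ?c) ?s ((5 + 4) * X ^ Suc 0)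
      (\<lambda>s'. I n s' \<and> frame (loop ''i'' ''n'' ?c) ?s s')"
  proof (rule runs_loop)
    fix k s' assume k: "k < n" "I k s'" "nats s' ''i'' 0 = k" "frame (loop ''i'' ''n'' ?c) ?s s'"
    have e: "nats s' ''d'' = nats s ''d''" "nats s' ''S'' = nats s ''S''" "reals s' ''h'' = reals s ''h''"
      "nats s' ''n'' 0 = n"
      using frame_nats[OF k(4)] frame_reals[OF k(4)] assms(1) by simp_all
    show "runs orc ?c s' (5 * X ^ 0) (I (Suc k))"
      by (intro runs_intros)
        (use k e in \<open>auto simp: I_def waiting_def members_def less_Suc_eq\<close>)
  qed (use assms in \<open>auto simp: I_def\<close>)
  then have "runs orc scan_agents s (1 + (5 + 4) * X ^ Suc 0) (I n)"
    unfolding scan_agents_def by (intro runs_Seq) (simp add: assms(1) runs_mono)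
  then have "runs orc scan_agents s (10 * X) (I n)"
    by (rule runs_mono) (use assms in auto)
  from runs_frame[OF this] show ?thesis
    by (rule runs_mono) (auto simp: I_def waiting_def)
qed

section \<open>Correctness and running time\<close>

text \<open>One parameter \<open>X\<close> bounds both sizes, as \<open>runs_loop\<close> expects.
  The oracle is specified only on sets of items, so every query requires that \<open>S\<close> stays
  within \<open>{..<m}\<close>.\<close>

locale fair_division =
  fixes n m X :: nat and F :: "nat set set" and v :: "nat \<Rightarrow> nat \<Rightarrow> real"
    and orc :: "nat \<Rightarrow> nat set \<Rightarrow> real"
  assumes hereditary: "hereditary_system {..<m} F"
    and v_nonneg: "\<And>i j. i < n \<Longrightarrow> j < m \<Longrightarrow> 0 \<le> v i j"
    and orc_eq: "\<And>i S. i < n \<Longrightarrow> S \<subseteq> {..<m} \<Longrightarrow> orc i S = valuation F (v i) S"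
    and size: "n \<le> X" "m \<le> X" "1 \<le> X"
begin

abbreviation val :: "nat \<Rightarrow> nat set \<Rightarrow> real" where
  "val i \<equiv> valuation F (v i)"

lemma finite_F: "finite F" and empty_in_F: "{} \<in> F" and F_subset: "S \<in> F \<Longrightarrow> S \<subseteq> {..<m}"
  using hereditary finite_subset[of F "Pow {..<m}"] unfolding hereditary_system_def by blast+

lemma val_mono: "S \<subseteq> S' \<Longrightarrow> val i S \<le> val i S'"
  using finite_F empty_in_F by (rule valuation_mono)

section \<open>Sets that satisfy a waiting agent, and shrinking them\<close>

definition good :: "nat set \<Rightarrow> (nat \<Rightarrow> real) \<Rightarrow> nat set \<Rightarrow> bool" where
  "good W h S \<longleftrightarrow> (\<exists>i\<in>W. h i \<le> val i S)"

lemma good_mono: "good W h S \<Longrightarrow> S \<subseteq> S' \<Longrightarrow> good W h S'"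
  unfolding good_def using val_mono order_trans by blast

text \<open>Deletions of single items are enough: by \<open>good_mono\<close>, no proper subset is
  good either.\<close>

definition irreducible :: "nat set \<Rightarrow> (nat \<Rightarrow> real) \<Rightarrow> nat set \<Rightarrow> bool" where
  "irreducible W h S \<longleftrightarrow> (\<forall>j\<in>S. \<not> good W h (S - {j}))"

text \<open>Take a satisfied agent and a feasible \<open>T\<close> that attains its value of
  \<open>S\<close>. An item of \<open>S\<close> outside \<open>T\<close> could be deleted without
  loss, so \<open>T\<close> is all of \<open>S\<close>.\<close>

lemma irreducible_in_F:
  assumes "irreducible W h S" "good W h S"
  shows "S \<in> F"
proof -
  obtain i where i: "i \<in> W" "h i \<le> val i S" using assms(2) unfolding good_def by blast
  obtain T where T: "T \<in> F" "T \<subseteq> S" "val i S = (\<Sum>j\<in>T. v i j)"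
    using valuation_attained[OF finite_F empty_in_F] by metis
  have "T = S"
  proof (rule ccontr)
    assume "T \<noteq> S"
    then obtain j where j: "j \<in> S" "T \<subseteq> S - {j}" using T(2) by blast
    have "h i \<le> val i (S - {j})"
      using sum_le_valuation[OF finite_F T(1) j(2), of "v i"] T(3) i(2) by simp
    then show False using assms(1) i(1) j(1) unfolding irreducible_def good_def by blast
  qed
  then show ?thesis using T(1) by simp
qed

lemma runs_scan_agents_good:
  assumes "nats s ''n'' 0 = n" "members s \<subseteq> {..<m}"
  shows "runs orc scan_agents s (10 * X) (\<lambda>s'. frame scan_agents s s' \<and>
    (if nats s' ''w'' 0 < n
     then nats s' ''w'' 0 \<in> waiting n s \<and> reals s ''h'' (nats s' ''w'' 0) \<le> val (nats s' ''w'' 0) (members s)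
     else \<not> good (waiting n s) (reals s ''h'') (members s)))"
  using runs_scan_agents[OF assms(1) size(1,3), of orc]
  by (rule runs_mono)
    (use orc_eq[OF _ assms(2)] in \<open>auto simp: good_def waiting_def not_le split: if_splits\<close>)

text \<open>One pass over the items suffices: an item that could not be deleted cannot be deleted
  later, because the set only gets smaller and \<open>good\<close> is monotone. If the initial set
  is not good, no subset is, and irreducibility is vacuous.\<close>

lemma runs_shrink:
  assumes s: "nats s ''n'' 0 = n" "nats s ''m'' 0 = m" "members s \<subseteq> {..<m}"
  shows "runs orc shrink s (18 * X ^ 2) (\<lambda>s'. frame shrink s s' \<and> members s' \<subseteq> members s \<and>
    (good (waiting n s) (reals s ''h'') (members s) \<longrightarrow>
      good (waiting n s) (reals s ''h'') (members s')) \<and>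
    irreducible (waiting n s) (reals s ''h'') (members s'))"
proof -
  define c where "c = (Cond (NLess (NElem ''S'' (V ''k'')) (NConst 1)) Skip
    (Seq (NAssign ''S'' (V ''k'') (NConst 0))
      (Seq scan_agents
        (Cond (NLess (V ''w'') (V ''n'')) Skip (NAssign ''S'' (V ''k'') (NConst 1))))))"
  let ?g = "good (waiting n s) (reals s ''h'')"
  define I where "I k s' \<longleftrightarrow> members s' \<subseteq> members s \<and> (?g (members s) \<longrightarrow> ?g (members s')) \<and>
    (\<forall>j\<in>members s'. j < k \<longrightarrow> \<not> ?g (members s' - {j}))" for k :: nat and s' :: state
  have nw: "nwritten c = {''S'', ''w'', ''i''}" "rwritten c = {''r''}"
    by (auto simp: c_def scan_agents_def)
  have shrink: "shrink = loop ''k'' ''m'' c" by (simp add: shrink_def c_def)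
  have "runs orc (loop ''k'' ''m'' c) s ((14 + 4) * X ^ Suc 1)
      (\<lambda>s'. I m s' \<and> frame (loop ''k'' ''m'' c) s s')"
  proof (rule runs_loop)
    fix k s' assume k: "k < m" "I k s'" "nats s' ''k'' 0 = k" and fr: "frame (loop ''k'' ''m'' c) s s'"
    have e: "nats s' ''d'' = nats s ''d''" "reals s' ''h'' = reals s ''h''" "nats s' ''n'' 0 = n"
      using frame_nats[OF fr] frame_reals[OF fr] s by (simp_all add: nw)
    let ?M = "members s'"
    have "runs orc c s' (10 * X + 4) (I (Suc k))"
    proof (cases "k \<in> ?M")
      case False
      then show ?thesis unfolding c_def
        by (intro runs_intros)
          (use k e in \<open>auto simp: I_def members_def less_Suc_eq\<close>)
    next
      case True
      let ?s = "nwrite ''S'' k 0 s'"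
      have M: "members ?s = ?M - {k}" by (auto simp: members_def)
      have W: "waiting n ?s = waiting n s" using e by (simp add: waiting_def)
      have "runs orc (Seq scan_agents
        (Cond (NLess (V ''w'') (V ''n'')) Skip (NAssign ''S'' (V ''k'') (NConst 1)))) ?s (10 * X + 2) (I (Suc k))"
      proof (rule runs_Seq_bound[OF runs_scan_agents_good])
        show "nats ?s ''n'' 0 = n" using e by simp
        show "members ?s \<subseteq> {..<m}" using k(2) s(3) unfolding M by (auto simp: I_def)
        fix s1 assume s1: "frame scan_agents ?s s1 \<and> (if nats s1 ''w'' 0 < n
           then nats s1 ''w'' 0 \<in> waiting n ?s \<and>
             reals ?s ''h'' (nats s1 ''w'' 0) \<le> val (nats s1 ''w'' 0) (members ?s)
           else \<not> good (waiting n ?s) (reals ?s ''h'') (members ?s))"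
        then have fr1: "frame scan_agents ?s s1" by blast
        have e1: "nats s1 ''S'' = (nats s' ''S'')(k := 0)" "nats s1 ''n'' 0 = n" "nats s1 ''k'' 0 = k"
          using frame_nats[OF fr1] e k(3) by (simp_all add: scan_agents_def)
        have found: "nats s1 ''w'' 0 < n \<longleftrightarrow> ?g (?M - {k})"
          using s1 by (auto simp: W M e good_def split: if_splits)
        have M1: "members s1 = ?M - {k}" using e1 by (auto simp: members_def)
        have M2: "members (nwrite ''S'' k 1 s1) = ?M"
          using e1 True by (auto simp: members_def)
        \<comment> \<open>Item \<open>k\<close> stays out, and the items kept earlier remain
          indispensable in the smaller set.\<close>
        have I1: "I (Suc k) s1" if "?g (?M - {k})"
        proof -
          have "\<not> ?g (?M - {k} - {j})" if "j \<in> ?M - {k}" "j < Suc k" for j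
          proof -
            have "\<not> ?g (?M - {j})" using k(2) that by (auto simp: I_def)
            then show ?thesis using good_mono by blast
          qed
          then show ?thesis using that k(2) unfolding I_def M1 by auto
        qed
        have I2: "I (Suc k) (nwrite ''S'' k 1 s1)" if "\<not> ?g (?M - {k})"
          using that k(2) unfolding I_def M2 by (auto simp: less_Suc_eq)
        show "runs orc (Cond (NLess (V ''w'') (V ''n'')) Skip (NAssign ''S'' (V ''k'') (NConst 1)))
           s1 2 (I (Suc k))"
          by (intro runs_intros) (use found I1 I2 e1 in simp_all)
      qed simp
      then show ?thesis unfolding c_def
        by (intro runs_intros) (use k e True in \<open>simp_all add: members_def\<close>)
    qed
    then show "runs orc c s' (14 * X ^ 1) (I (Suc k))"
      by (rule runs_mono) (use size in auto)
  qed (use s size in \<open>auto simp: I_def nw members_def\<close>)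
  then show ?thesis unfolding shrink[symmetric]
    by (rule runs_mono) (use s(3) in \<open>auto simp: I_def irreducible_def power2_eq_square\<close>)
qed

section \<open>Handing out one bundle\<close>

definition unowned :: "state \<Rightarrow> nat set" where
  "unowned s = {j. j < m \<and> n \<le> nats s ''owner'' j}"

lemma runs_collect_free:
  assumes s: "nats s ''n'' 0 = n" "nats s ''m'' 0 = m" "members s \<subseteq> {..<m}"
  shows "runs orc collect_free s (6 * X) (\<lambda>s'. frame collect_free s s' \<and> members s' = unowned s)"
proof -
  define c where "c = (Cond (NLess (NElem ''owner'' (V ''j'')) (V ''n''))
    (NAssign ''S'' (V ''j'') (NConst 0)) (NAssign ''S'' (V ''j'') (NConst 1)))"
  define I where "I k s' \<longleftrightarrow> members s' \<subseteq> {..<m} \<and>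
    (\<forall>j<k. nats s' ''S'' j = (if nats s ''owner'' j < n then 0 else 1))" for k :: nat and s' :: state
  have cf: "collect_free = loop ''j'' ''m'' c" by (simp add: collect_free_def c_def)
  have nw: "nwritten c = {''S''}" by (auto simp: c_def)
  have "runs orc (loop ''j'' ''m'' c) s ((2 + 4) * X ^ Suc 0)
      (\<lambda>s'. I m s' \<and> frame (loop ''j'' ''m'' c) s s')"
  proof (rule runs_loop)
    fix k s' assume k: "k < m" "I k s'" "nats s' ''j'' 0 = k" and fr: "frame (loop ''j'' ''m'' c) s s'"
    have e: "nats s' ''owner'' = nats s ''owner''" "nats s' ''n'' 0 = n"
      using frame_nats[OF fr] s by (simp_all add: nw)
    show "runs orc c s' (2 * X ^ 0) (I (Suc k))"
      unfolding c_def by (intro runs_intros)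
        (use k e in \<open>auto simp: I_def members_def less_Suc_eq\<close>)
  qed (use s size in \<open>auto simp: I_def nw members_def\<close>)
  then show ?thesis unfolding cf[symmetric]
    by (rule runs_mono) (auto simp: I_def unowned_def members_def split: if_splits)
qed

text \<open>Irreducibility refers to the agents waiting now, not to those waiting when the bundle
  was given. This weaker form survives later steps and is what the charging argument needs.\<close>

definition round_invariant :: "state \<Rightarrow> bool" where
  "round_invariant s \<longleftrightarrow> (\<forall>i\<in>waiting n s. allotted m s i = {}) \<and>
    (\<forall>k<n. k \<notin> waiting n s \<longrightarrow> allotted m s k \<in> F \<and>
      reals s ''h'' k \<le> val k (allotted m s k) \<and>
      irreducible (waiting n s) (reals s ''h'') (allotted m s k))"

lemma irreducible_antimono: "irreducible W h S \<Longrightarrow> W' \<subseteq> W \<Longrightarrow> irreducible W' h S"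
  unfolding irreducible_def good_def by blast

text \<open>Only unowned items change hands, so all other bundles stay the same. Irreducibility
  passes to the smaller set of waiting agents, and \<open>S\<close> is feasible by
  \<open>irreducible_in_F\<close>.\<close>

lemma round_invariant_give:
  assumes inv: "round_invariant s"
    and i: "i \<in> waiting n s" "reals s ''h'' i \<le> val i S"
    and S: "S \<subseteq> unowned s" "irreducible (waiting n s) (reals s ''h'') S"
    and s': "nats s' ''d'' = (nats s ''d'')(i := 1)" "reals s' ''h'' = reals s ''h''"
      "\<And>j. j < m \<Longrightarrow> nats s' ''owner'' j = (if j \<in> S then i else nats s ''owner'' j)"
  shows "round_invariant s'" "waiting n s' = waiting n s - {i}"
proof -
  show W: "waiting n s' = waiting n s - {i}" using s'(1) by (auto simp: waiting_def)
  have "i < n" using i(1) by (simp add: waiting_def)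
  have ai: "allotted m s' i = S"
  proof -
    have "allotted m s i = {}" using inv i(1) by (simp add: round_invariant_def)
    then have "j \<in> allotted m s' i \<longleftrightarrow> j \<in> S" for j
      using subsetD[OF S(1), of j] s'(3)[of j]
      by (cases "j \<in> S") (auto simp: allotted_def unowned_def)
    then show ?thesis by blast
  qed
  have ak: "allotted m s' k = allotted m s k" if "k < n" "k \<noteq> i" for k
  proof -
    have "j \<in> allotted m s' k \<longleftrightarrow> j \<in> allotted m s k" for j
      using subsetD[OF S(1), of j] s'(3)[of j] that
      by (cases "j \<in> S") (auto simp: allotted_def unowned_def)
    then show ?thesis by blast
  qed
  have wk: "k < n" "k \<noteq> i" "allotted m s k = {}" if "k \<in> waiting n s'" for k
    using that inv W by (auto simp: round_invariant_def waiting_def)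
  have "S \<in> F"
    by (rule irreducible_in_F[OF S(2)]) (use i in \<open>auto simp: good_def\<close>)
  then have "allotted m s' k \<in> F \<and> reals s' ''h'' k \<le> val k (allotted m s' k) \<and>
      irreducible (waiting n s) (reals s' ''h'') (allotted m s' k)"
    if "k < n" "k \<notin> waiting n s'" for k
    using that inv i(2) S(2) ai ak[of k] W s'(2)
    by (cases "k = i") (auto simp: round_invariant_def)
  then show "round_invariant s'"
    unfolding round_invariant_def using wk ak irreducible_antimono[of "waiting n s"] W by simp
qed

lemma runs_give:
  assumes s: "nats s ''n'' 0 = n" "nats s ''m'' 0 = m" and S: "members s \<subseteq> unowned s"
    and inv: "round_invariant s" and irr: "irreducible (waiting n s) (reals s ''h'') (members s)"
  shows "runs orc give s (18 * X) (\<lambda>s'. frame give s s' \<and> round_invariant s' \<and>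
    (good (waiting n s) (reals s ''h'') (members s) \<and> Suc (card (waiting n s')) = card (waiting n s) \<or>
     \<not> good (waiting n s) (reals s ''h'') (members s) \<and> waiting n s' = waiting n s \<and>
       unowned s' = unowned s))"
    (is "runs _ _ _ _ (\<lambda>s'. _ \<and> ?Q s')")
proof -
  define c where "c = Cond (NLess (NElem ''S'' (V ''j'')) (NConst 1)) Skip
        (NAssign ''owner'' (V ''j'') (V ''w''))"
  define c2 where "c2 = Cond (NLess (V ''w'') (V ''n''))
    (Seq (NAssign ''d'' (V ''w'') (NConst 1)) (loop ''j'' ''m'' c)) Skip"
  have nw: "nwritten c = {''owner''}" "rwritten c = {}" by (auto simp: c_def)
  have give: "give = Seq scan_agents c2" by (simp add: give_def c_def c2_def)
  have "runs orc (Seq scan_agents c2) s (18 * X) ?Q"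
  proof (rule runs_Seq_bound[OF runs_scan_agents_good])
    show "nats s ''n'' 0 = n" by (rule s)
    show "members s \<subseteq> {..<m}" using S by (auto simp: unowned_def)
    fix s1 assume s1: "frame scan_agents s s1 \<and> (if nats s1 ''w'' 0 < n
       then nats s1 ''w'' 0 \<in> waiting n s \<and>
         reals s ''h'' (nats s1 ''w'' 0) \<le> val (nats s1 ''w'' 0) (members s)
       else \<not> good (waiting n s) (reals s ''h'') (members s))"
    then have fr1: "frame scan_agents s s1" by blast
    have e1: "nats s1 ''S'' = nats s ''S''" "nats s1 ''n'' 0 = n" "nats s1 ''m'' 0 = m"
      "nats s1 ''d'' = nats s ''d''" "nats s1 ''owner'' = nats s ''owner''"
      "reals s1 ''h'' = reals s ''h''"
      using frame_nats[OF fr1] frame_reals[OF fr1] s by (simp_all add: scan_agents_def)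
    show "runs orc c2 s1 (8 * X) ?Q"
    proof (cases "nats s1 ''w'' 0 < n")
      case False
      have "?Q s1" using False s1 inv e1
        by (auto simp: round_invariant_def waiting_def allotted_def unowned_def)
      then show ?thesis unfolding c2_def
        by (intro runs_intros) (use False e1 size in simp_all)
    next
      case True
      define i where "i = nats s1 ''w'' 0"
      have i: "i \<in> waiting n s" "reals s ''h'' i \<le> val i (members s)"
        using True s1 by (auto simp: i_def)
      let ?s = "nwrite ''d'' i 1 s1"
      define I where "I k s' \<longleftrightarrow> (\<forall>j<m. nats s' ''owner'' j =
        (if j < k \<and> j \<in> members s then i else nats s ''owner'' j))" for k :: nat and s' :: state
      have "runs orc (loop ''j'' ''m'' c) ?s ((2 + 4) * X ^ Suc 0)
          (\<lambda>s'. I m s' \<and> frame (loop ''j'' ''m'' c) ?s s')"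
      proof (rule runs_loop)
        fix k s' assume k: "k < m" "I k s'" "nats s' ''j'' 0 = k"
          and fr: "frame (loop ''j'' ''m'' c) ?s s'"
        have e: "nats s' ''w'' 0 = i" "nats s' ''S'' = nats s ''S''"
          using frame_nats[OF fr] e1 by (simp_all add: nw i_def)
        show "runs orc c s' (2 * X ^ 0) (I (Suc k))"
          unfolding c_def by (intro runs_intros)
            (use k e in \<open>auto simp: I_def members_def less_Suc_eq\<close>)
      qed (use size e1 in \<open>auto simp: I_def nw\<close>)
      then have "runs orc (loop ''j'' ''m'' c) ?s (6 * X) ?Q"
      proof (rule runs_mono)
        fix s' assume s': "I m s' \<and> frame (loop ''j'' ''m'' c) ?s s'"
        then have fr: "frame (loop ''j'' ''m'' c) ?s s'" by blast
        have d: "nats s' ''d'' = (nats s ''d'')(i := 1)" "reals s' ''h'' = reals s ''h''"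
          using frame_nats[OF fr] frame_reals[OF fr] e1 by (simp_all add: nw)
        have o: "nats s' ''owner'' j = (if j \<in> members s then i else nats s ''owner'' j)"
          if "j < m" for j using s' that by (simp add: I_def)
        have *: "round_invariant s'" "waiting n s' = waiting n s - {i}"
          using round_invariant_give[OF inv i S irr d o] by simp_all
        have "finite (waiting n s)" by (simp add: waiting_def)
        then have "Suc (card (waiting n s')) = card (waiting n s)"
          unfolding *(2) using i(1) by (rule card_Suc_Diff1)
        moreover have "good (waiting n s) (reals s ''h'') (members s)"
          using i by (auto simp: good_def)
        ultimately show "?Q s'" using * by simp
      qed simp
      then have "runs orc (loop ''j'' ''m'' c) ?s (8 * X - 1 - 1) ?Q"
        by (rule runs_mono) (use size in auto)
      then show ?thesis unfolding c2_def
        by (intro runs_intros) (use True e1 size in \<open>simp_all add: i_def\<close>)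
    qed
  qed simp
  then show ?thesis unfolding give[symmetric] by (rule runs_mono[OF runs_frame]) auto
qed

text \<open>Shrinking preserves goodness and \<open>good_mono\<close> gives the converse, so the
  shrunk set is good exactly if the set of free items is. A step that serves nobody thus shows that
  the free items satisfy no waiting agent; it changes neither set, so this persists.\<close>

lemma runs_step:
  assumes s: "nats s ''n'' 0 = n" "nats s ''m'' 0 = m" "members s \<subseteq> {..<m}"
    and inv: "round_invariant s"
  shows "runs orc step s (42 * X ^ 2) (\<lambda>s'. frame step s s' \<and> members s' \<subseteq> {..<m} \<and>
    round_invariant s' \<and>
    (Suc (card (waiting n s')) = card (waiting n s) \<or>
     \<not> good (waiting n s') (reals s ''h'') (unowned s')) \<and>
    (\<not> good (waiting n s) (reals s ''h'') (unowned s) \<longrightarrow>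
     \<not> good (waiting n s') (reals s ''h'') (unowned s')))"
    (is "runs _ _ _ _ (\<lambda>s'. _ \<and> ?Q s')")
proof -
  let ?g = "good (waiting n s) (reals s ''h'')"
  have free: "unowned s \<subseteq> {..<m}" by (auto simp: unowned_def)
  have "runs orc step s (42 * X ^ 2) ?Q"
    unfolding step_def
  proof (rule runs_Seq_bound[OF runs_collect_free[OF s]])
    fix s1 assume s1: "frame collect_free s s1 \<and> members s1 = unowned s"
    then have fr1: "frame collect_free s s1" by blast
    have e1: "nats s1 ''n'' 0 = n" "nats s1 ''m'' 0 = m" "nats s1 ''d'' = nats s ''d''"
      "nats s1 ''owner'' = nats s ''owner''" "reals s1 ''h'' = reals s ''h''"
      using frame_nats[OF fr1] frame_reals[OF fr1] s by (simp_all add: collect_free_def)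
    have "members s1 \<subseteq> {..<m}" using s1 free by simp
    note sh = runs_shrink[OF e1(1,2) this]
    have w1: "waiting n s1 = waiting n s" using e1 by (simp add: waiting_def)
    show "runs orc (Seq shrink give) s1 (18 * X ^ 2 + 18 * X) ?Q"
    proof (rule runs_Seq_bound[OF sh])
      fix s2 assume s2: "frame shrink s1 s2 \<and> members s2 \<subseteq> members s1 \<and>
        (good (waiting n s1) (reals s1 ''h'') (members s1) \<longrightarrow>
          good (waiting n s1) (reals s1 ''h'') (members s2)) \<and>
        irreducible (waiting n s1) (reals s1 ''h'') (members s2)"
      then have fr2: "frame shrink s1 s2" by blast
      have e2: "nats s2 ''n'' 0 = n" "nats s2 ''m'' 0 = m" "nats s2 ''d'' = nats s ''d''"
        "nats s2 ''owner'' = nats s ''owner''" "reals s2 ''h'' = reals s ''h''"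
        using frame_nats[OF fr2] frame_reals[OF fr2] e1 by (simp_all add: shrink_def scan_agents_def)
      have w2: "waiting n s2 = waiting n s" using e2 by (simp add: waiting_def)
      have u2: "unowned s2 = unowned s" using e2 by (simp add: unowned_def)
      have sub: "members s2 \<subseteq> unowned s2" using s1 s2 u2 by auto
      have inv2: "round_invariant s2"
        using inv e2 by (simp add: round_invariant_def waiting_def allotted_def)
      have irr: "irreducible (waiting n s2) (reals s2 ''h'') (members s2)"
        using s2 w1 w2 e1 e2 by simp
      have imp: "?g (unowned s) \<longrightarrow> ?g (members s2)" using s2 s1 w1 e1 by simp
      have imp': "?g (members s2) \<longrightarrow> ?g (unowned s)"
        using good_mono sub u2 by blast
      show "runs orc give s2 (18 * X) ?Q"
      proof (rule runs_mono[OF runs_give[OF e2(1,2) sub inv2 irr]])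
        fix s' assume s': "frame give s2 s' \<and> round_invariant s' \<and>
          (good (waiting n s2) (reals s2 ''h'') (members s2) \<and>
             Suc (card (waiting n s')) = card (waiting n s2) \<or>
           \<not> good (waiting n s2) (reals s2 ''h'') (members s2) \<and> waiting n s' = waiting n s2 \<and>
             unowned s' = unowned s2)"
        then have fr': "frame give s2 s'" by blast
        have "nats s' ''S'' = nats s2 ''S''"
          using frame_nats[OF fr'] by (simp add: give_def scan_agents_def)
        then have "members s' \<subseteq> {..<m}" using sub u2 free by (auto simp: members_def)
        then show "?Q s'" using s' w2 u2 e2 imp imp' by auto
      qed simp
    qed simp
  next
    have "X * 1 \<le> X * X" by (rule mult_le_mono2) (rule size)
    then show "6 * X + (18 * X ^ 2 + 18 * X) \<le> 42 * X ^ 2" by (simp add: power2_eq_square)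
  qed
  then show ?thesis by (rule runs_mono[OF runs_frame]) auto
qed

text \<open>Each step serves an agent or reaches the permanent state of failure, so \<open>n\<close>
  steps exhaust the round.\<close>

lemma runs_steps:
  assumes s: "nats s ''n'' 0 = n" "nats s ''m'' 0 = m" "members s \<subseteq> {..<m}"
    and inv: "round_invariant s"
  shows "runs orc (loop ''a'' ''n'' step) s (46 * X ^ 3) (\<lambda>s'. frame (loop ''a'' ''n'' step) s s' \<and>
    members s' \<subseteq> {..<m} \<and> round_invariant s' \<and>
    \<not> good (waiting n s') (reals s' ''h'') (unowned s'))"
proof -
  define I where "I k s' \<longleftrightarrow> members s' \<subseteq> {..<m} \<and> round_invariant s' \<and>
    (card (waiting n s') + k \<le> n \<or> \<not> good (waiting n s') (reals s' ''h'') (unowned s'))"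
    for k :: nat and s' :: state
  have nw: "nwritten step = {''j'', ''k'', ''i'', ''S'', ''w'', ''d'', ''owner''}"
    "rwritten step = {''r''}"
    by (auto simp: step_def collect_free_def shrink_def give_def scan_agents_def)
  have w: "finite (waiting n s')" "card (waiting n s') \<le> n" for s'
    using card_mono[of "{..<n}" "waiting n s'"] by (auto simp: waiting_def)
  have "runs orc (loop ''a'' ''n'' step) s ((42 + 4) * X ^ Suc 2)
      (\<lambda>s'. I n s' \<and> frame (loop ''a'' ''n'' step) s s')"
  proof (rule runs_loop)
    fix k s' assume k: "k < n" "I k s'" "nats s' ''a'' 0 = k"
      and fr: "frame (loop ''a'' ''n'' step) s s'"
    have e: "nats s' ''n'' 0 = n" "nats s' ''m'' 0 = m"
      using frame_nats[OF fr] s by (simp_all add: nw)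
    have p: "members s' \<subseteq> {..<m}" "round_invariant s'" using k(2) by (simp_all add: I_def)
    show "runs orc step s' (42 * X ^ 2) (I (Suc k))"
    proof (rule runs_mono[OF runs_step[OF e p]])
      fix s'' assume *: "frame step s' s'' \<and> members s'' \<subseteq> {..<m} \<and> round_invariant s'' \<and>
        (Suc (card (waiting n s'')) = card (waiting n s') \<or>
         \<not> good (waiting n s'') (reals s' ''h'') (unowned s'')) \<and>
        (\<not> good (waiting n s') (reals s' ''h'') (unowned s') \<longrightarrow>
         \<not> good (waiting n s'') (reals s' ''h'') (unowned s''))"
      then have "reals s'' ''h'' = reals s' ''h''"
        using frame_reals[of step s' s'' "''h''"] by (simp add: nw)
      with * show "I (Suc k) s''" using k(2) by (auto simp: I_def)
    qed simp
  next
    show "I k (nwrite ''a'' 0 l s') \<longleftrightarrow> I k s'" for k l s'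
      by (simp add: I_def members_def round_invariant_def waiting_def allotted_def unowned_def)
  qed (use s size inv w in \<open>auto simp: I_def nw\<close>)
  then show ?thesis
  proof (rule runs_mono)
    fix s' assume *: "I n s' \<and> frame (loop ''a'' ''n'' step) s s'"
    have "\<not> good (waiting n s') (reals s' ''h'') (unowned s')"
    \<comment> \<open>With \<open>k = n\<close> the first alternative of \<open>I\<close> leaves no
      waiting agent, and then no set is good.\<close>
    proof (cases "card (waiting n s') = 0")
      case True
      then show ?thesis using w(1)[of s'] by (simp add: good_def)
    qed (use * in \<open>auto simp: I_def\<close>)
    then show "frame (loop ''a'' ''n'' step) s s' \<and>
      members s' \<subseteq> {..<m} \<and> round_invariant s' \<and>
      \<not> good (waiting n s') (reals s' ''h'') (unowned s')" using * by (auto simp: I_def)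
  qed simp
qed

text \<open>This is the charging argument applied to the served agents. As \<open>i\<close> is
  waiting, irreducibility says that each bundle minus any one item is below the threshold of
  \<open>i\<close>.\<close>

lemma waiting_threshold:
  assumes inv: "round_invariant s"
    and bad: "\<not> good (waiting n s) (reals s ''h'') (unowned s)"
    and i: "i \<in> waiting n s"
  shows "11 / 30 * mms {..<m} n (val i) < reals s ''h'' i"
proof (rule mms_less_if_unsatisfied[where A = "allotted m s" and D = "{..<n} - waiting n s"])
  show "hereditary_system {..<m} F" by (rule hereditary)
  show "i < n" using i by (simp add: waiting_def)
  then show "0 \<le> v i j" if "j \<in> {..<m}" for j using that v_nonneg by simp
  show "allotted m s k \<in> F" if "k \<in> {..<n} - waiting n s" for k
    using inv that by (simp add: round_invariant_def)
  show "val i (allotted m s k - {j}) < reals s ''h'' i"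
    if "k \<in> {..<n} - waiting n s" "j \<in> allotted m s k" for k j
    using inv that i by (auto simp: round_invariant_def irreducible_def good_def not_le)
  \<comment> \<open>An item whose owner is below \<open>n\<close> belongs to a served agent, because
    waiting agents own nothing.\<close>
  have "{..<m} - (\<Union>k\<in>{..<n} - waiting n s. allotted m s k) = unowned s"
  proof (rule set_eqI)
    fix j
    have "nats s ''owner'' j \<notin> waiting n s" if "j < m"
    proof
      assume "nats s ''owner'' j \<in> waiting n s"
      then have "allotted m s (nats s ''owner'' j) = {}" using inv by (simp add: round_invariant_def)
      then show False using that by (auto simp: allotted_def)
    qed
    then show "j \<in> {..<m} - (\<Union>k\<in>{..<n} - waiting n s. allotted m s k) \<longleftrightarrow> j \<in> unowned s"
      by (auto simp: unowned_def allotted_def not_less)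
  qed
  then show "val i ({..<m} - (\<Union>k\<in>{..<n} - waiting n s. allotted m s k)) < reals s ''h'' i"
    using bad i by (auto simp: good_def not_le)
qed (use i in \<open>auto simp: disjoint_family_on_def allotted_def\<close>)

section \<open>One round, including the lowering of thresholds\<close>

lemma runs_reset_owner:
  assumes s: "nats s ''n'' 0 = n" "nats s ''m'' 0 = m"
  shows "runs orc (loop ''j'' ''m'' (NAssign ''owner'' (V ''j'') (V ''n''))) s (5 * X)
    (\<lambda>s'. frame (loop ''j'' ''m'' (NAssign ''owner'' (V ''j'') (V ''n''))) s s' \<and>
      (\<forall>j<m. nats s' ''owner'' j = n))"
    (is "runs _ (loop _ _ ?c) _ _ _")
proof -
  have "runs orc (loop ''j'' ''m'' ?c) s ((1 + 4) * X ^ Suc 0)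
      (\<lambda>s'. (\<forall>j<m. nats s' ''owner'' j = n) \<and> frame (loop ''j'' ''m'' ?c) s s')"
  proof (rule runs_loop[where I = "\<lambda>k s'. \<forall>j<k. nats s' ''owner'' j = n"])
    fix k s' assume k: "k < m" "\<forall>j<k. nats s' ''owner'' j = n" "nats s' ''j'' 0 = k"
      and fr: "frame (loop ''j'' ''m'' ?c) s s'"
    have "nats s' ''n'' 0 = n" using frame_nats[OF fr] s by simp
    then show "runs orc ?c s' (1 * X ^ 0) (\<lambda>s'. \<forall>j<Suc k. nats s' ''owner'' j = n)"
      using k by (simp add: less_Suc_eq)
  qed (use s size in simp_all)
  then show ?thesis by (rule runs_mono) simp_all
qed

lemma runs_reset_waiting:
  assumes s: "nats s ''n'' 0 = n"
  shows "runs orc (loop ''i'' ''n'' (NAssign ''d'' (V ''i'') (NConst 0))) s (5 * X)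
    (\<lambda>s'. frame (loop ''i'' ''n'' (NAssign ''d'' (V ''i'') (NConst 0))) s s' \<and>
      waiting n s' = {..<n})"
    (is "runs _ (loop _ _ ?c) _ _ _")
proof -
  have "runs orc (loop ''i'' ''n'' ?c) s ((1 + 4) * X ^ Suc 0)
      (\<lambda>s'. (\<forall>i<n. nats s' ''d'' i = 0) \<and> frame (loop ''i'' ''n'' ?c) s s')"
    by (rule runs_loop[where I = "\<lambda>k s'. \<forall>i<k. nats s' ''d'' i = 0"])
      (use s size in \<open>simp_all add: less_Suc_eq\<close>)
  then show ?thesis by (rule runs_mono) (auto simp: waiting_def)
qed

lemma of_rat_ratio: "of_rat (of_nat K / (of_nat K + 1)) = real K / (real K + 1)"
  by (simp add: of_rat_divide of_rat_add)

lemma runs_lower: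
  assumes s: "nats s ''n'' 0 = n" "nats s ''g'' 0 = 0"
  shows "runs orc (lower K) s (7 * X) (\<lambda>s'. frame (lower K) s s' \<and>
    (nats s' ''g'' 0 = 0 \<longleftrightarrow> waiting n s = {}) \<and>
    (\<forall>i<n. reals s' ''h'' i =
      (if i \<in> waiting n s then real K / (real K + 1) * reals s ''h'' i else reals s ''h'' i)))"
proof -
  define c where "c = (Cond (NLess (NElem ''d'' (V ''i'')) (NConst 1))
        (Seq (RAssign ''h'' (V ''i'')
            (RScale (of_nat K / (of_nat K + 1)) (RElem ''h'' (V ''i''))))
          (NAssign ''g'' (NConst 0) (NConst 1)))
        Skip)"
  define I where "I k s' \<longleftrightarrow> (nats s' ''g'' 0 = 0 \<longleftrightarrow> (\<forall>i<k. i \<notin> waiting n s)) \<and>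
    (\<forall>i. reals s' ''h'' i = (if i < k \<and> i \<in> waiting n s
       then real K / (real K + 1) * reals s ''h'' i else reals s ''h'' i))"
    for k :: nat and s' :: state
  have c: "lower K = loop ''i'' ''n'' c" by (simp add: c_def lower_def)
  have nw: "nwritten c = {''g''}" "rwritten c = {''h''}" by (auto simp: c_def)
  have "runs orc (loop ''i'' ''n'' c) s ((3 + 4) * X ^ Suc 0)
      (\<lambda>s'. I n s' \<and> frame (loop ''i'' ''n'' c) s s')"
  proof (rule runs_loop)
    fix k s' assume k: "k < n" "I k s'" "nats s' ''i'' 0 = k" and fr: "frame (loop ''i'' ''n'' c) s s'"
    have e: "nats s' ''d'' = nats s ''d''" using frame_nats[OF fr] by (simp add: nw)
    show "runs orc c s' (3 * X ^ 0) (I (Suc k))"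
      unfolding c_def by (intro runs_intros)
        (use k e in \<open>auto simp: I_def waiting_def less_Suc_eq of_rat_ratio\<close>)
  qed (use s size in \<open>auto simp: I_def nw\<close>)
  then show ?thesis unfolding c
    by (rule runs_mono) (auto simp: I_def waiting_def)
qed

text \<open>Here \<open>W\<close> stands for the agents left waiting. The last two conjuncts use the
  thresholds before lowering; if \<open>W\<close> is empty these are also the final ones.\<close>

definition round_result :: "nat \<Rightarrow> state \<Rightarrow> state \<Rightarrow> nat set \<Rightarrow> bool" where
  "round_result K s s' W \<longleftrightarrow> W \<subseteq> {..<n} \<and> (nats s' ''g'' 0 = 0 \<longleftrightarrow> W = {}) \<and>
    (\<forall>i<n. reals s' ''h'' i =
      (if i \<in> W then real K / (real K + 1) * reals s ''h'' i else reals s ''h'' i)) \<and>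
    (\<forall>i\<in>W. 11 / 30 * mms {..<m} n (val i) < reals s ''h'' i) \<and>
    (\<forall>i<n. i \<notin> W \<longrightarrow> reals s ''h'' i \<le> val i (allotted m s' i))"

lemma runs_round:
  assumes s: "nats s ''n'' 0 = n" "nats s ''m'' 0 = m" "members s \<subseteq> {..<m}"
  shows "runs orc (allocation_round K) s (64 * X ^ 3) (\<lambda>s'. frame (allocation_round K) s s' \<and> members s' \<subseteq> {..<m} \<and>
    (\<exists>W. round_result K s s' W))"
proof -
  let ?Q = "\<lambda>s'. members s' \<subseteq> {..<m} \<and> (\<exists>W. round_result K s s' W)"
  let ?c1 = "loop ''j'' ''m'' (NAssign ''owner'' (V ''j'') (V ''n''))"
  let ?c2 = "loop ''i'' ''n'' (NAssign ''d'' (V ''i'') (NConst 0))"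
  let ?c3 = "loop ''a'' ''n'' step"
  let ?s = "nwrite ''g'' 0 0 s"
  have nw: "nwritten step = {''j'', ''k'', ''i'', ''S'', ''w'', ''d'', ''owner''}"
    "rwritten step = {''r''}"
    by (auto simp: step_def collect_free_def shrink_def give_def scan_agents_def)
  \<comment> \<open>Linear costs are rounded up to \<open>X ^ 3\<close>, and the budget is 1 + 5 + 5
    + 46 + 7 = 64.\<close>
  have X: "X \<le> X ^ 3" using size by (simp add: self_le_power)
  have s0: "nats ?s ''n'' 0 = n" "nats ?s ''m'' 0 = m" using s by simp_all
  have "runs orc (Seq ?c1 (Seq ?c2 (Seq ?c3 (lower K)))) ?s (64 * X ^ 3 - 1) ?Q"
  proof (rule runs_Seq_bound[OF runs_reset_owner[OF s0]])
    fix s1 assume *: "frame ?c1 ?s s1 \<and> (\<forall>j<m. nats s1 ''owner'' j = n)"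
    then have fr: "frame ?c1 ?s s1" by blast
    have s1: "nats s1 ''n'' 0 = n" "nats s1 ''m'' 0 = m" "nats s1 ''g'' 0 = 0"
      "reals s1 ''h'' = reals s ''h''" "members s1 = members s"
      using frame_nats[OF fr] frame_reals[OF fr] s by (simp_all add: members_def)
    show "runs orc (Seq ?c2 (Seq ?c3 (lower K))) s1 (58 * X ^ 3) ?Q"
    proof (rule runs_Seq_bound[OF runs_reset_waiting[OF s1(1)]])
      fix s2 assume **: "frame ?c2 s1 s2 \<and> waiting n s2 = {..<n}"
      then have fr: "frame ?c2 s1 s2" by blast
      have s2: "nats s2 ''n'' 0 = n" "nats s2 ''m'' 0 = m" "nats s2 ''g'' 0 = 0"
        "reals s2 ''h'' = reals s ''h''" "members s2 \<subseteq> {..<m}" "\<forall>j<m. nats s2 ''owner'' j = n"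
        using frame_nats[OF fr] frame_reals[OF fr] s s1 * by (simp_all add: members_def)
      have inv: "round_invariant s2"
        using ** s2 by (auto simp: round_invariant_def allotted_def)
      show "runs orc (Seq ?c3 (lower K)) s2 (53 * X ^ 3) ?Q"
      proof (rule runs_Seq_bound[OF runs_steps[OF s2(1,2,5) inv]])
        fix s3 assume ***: "frame ?c3 s2 s3 \<and> members s3 \<subseteq> {..<m} \<and> round_invariant s3 \<and>
          \<not> good (waiting n s3) (reals s3 ''h'') (unowned s3)"
        then have fr: "frame ?c3 s2 s3" by blast
        have s3: "nats s3 ''n'' 0 = n" "nats s3 ''g'' 0 = 0" "reals s3 ''h'' = reals s ''h''"
          using frame_nats[OF fr] frame_reals[OF fr] s2 by (simp_all add: nw)
        show "runs orc (lower K) s3 (7 * X) ?Q"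
        proof (rule runs_mono[OF runs_lower[OF s3(1,2)]])
          fix s4 assume s4: "frame (lower K) s3 s4 \<and>
            (nats s4 ''g'' 0 = 0 \<longleftrightarrow> waiting n s3 = {}) \<and>
            (\<forall>i<n. reals s4 ''h'' i =
              (if i \<in> waiting n s3 then real K / (real K + 1) * reals s3 ''h'' i
               else reals s3 ''h'' i))"
          then have fr: "frame (lower K) s3 s4" by blast
          have e4: "allotted m s4 = allotted m s3" "members s4 = members s3"
            using frame_nats[OF fr] by (auto simp: lower_def allotted_def members_def fun_eq_iff)
          have "round_result K s s4 (waiting n s3)"
            unfolding round_result_def
            using s4 s3 e4 *** waiting_threshold[of s3]
            by (auto simp: waiting_def round_invariant_def)
          then show "?Q s4" using *** e4 by auto
        qed simp
      qed (use X in linarith)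
    qed (use X in linarith)
  next
    have "1 \<le> X ^ 3" using size by simp
    then show "5 * X + 58 * X ^ 3 \<le> 64 * X ^ 3 - 1" using X by linarith
  qed
  then have "runs orc (allocation_round K) s (64 * X ^ 3) ?Q"
    unfolding allocation_round_def
    by (intro runs_Seq_NAssign) (use size in simp_all)
  then show ?thesis by (rule runs_mono[OF runs_frame]) auto
qed

section \<open>Initial thresholds\<close>

text \<open>
  A frequent item has at least \<open>n\<close> items that are worth as much, hence it is worth at most
  \<open>MMS(i)\<close>; as fewer than \<open>n\<close> items are not frequent, some part of any partition consists of
  frequent items. So \<open>MMS(i) \<le> estimate i \<le> m * MMS(i)\<close>.
\<close>

definition frequent :: "nat \<Rightarrow> nat set" where
  "frequent i = {j \<in> {..<m}. n \<le> card {k \<in> {..<m}. val i {j} \<le> val i {k}}}"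

definition estimate :: "nat \<Rightarrow> real" where
  "estimate i = (\<Sum>j\<in>frequent i. val i {j})"

lemma runs_count:
  assumes s: "nats s ''m'' 0 = m" "nats s ''c'' 0 = 0" "nats s ''j'' 0 = j"
    "\<forall>k<m. reals s ''b'' k = val i {k}" "j < m"
  defines "c \<equiv> loop ''k'' ''m'' (Cond (RLess (RElem ''b'' (V ''k'')) (RElem ''b'' (V ''j''))) Skip
            (NAssign ''c'' (NConst 0) (NPlus (V ''c'') (NConst 1))))"
  shows "runs orc c s (6 * X)
    (\<lambda>s'. frame c s s' \<and> nats s' ''c'' 0 = card {k \<in> {..<m}. val i {j} \<le> val i {k}})"
proof -
  define c' where "c' = Cond (RLess (RElem ''b'' (V ''k'')) (RElem ''b'' (V ''j''))) Skip
            (NAssign ''c'' (NConst 0) (NPlus (V ''c'') (NConst 1)))"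
  have c: "c = loop ''k'' ''m'' c'" by (simp add: c_def c'_def)
  have nw: "nwritten c' = {''c''}" "rwritten c' = {}" by (auto simp: c'_def)
  define I where "I k s' \<longleftrightarrow> nats s' ''c'' 0 = card {l \<in> {..<k}. val i {j} \<le> val i {l}}"
    for k :: nat and s' :: state
  have "runs orc (loop ''k'' ''m'' c') s ((2 + 4) * X ^ Suc 0)
      (\<lambda>s'. I m s' \<and> frame (loop ''k'' ''m'' c') s s')"
  proof (rule runs_loop)
    fix k s' assume k: "k < m" "I k s'" "nats s' ''k'' 0 = k" and fr: "frame (loop ''k'' ''m'' c') s s'"
    have e: "nats s' ''j'' 0 = j" "reals s' ''b'' k = val i {k}" "reals s' ''b'' j = val i {j}"
      using frame_nats[OF fr] frame_reals[OF fr] s k(1) by (simp_all add: nw)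
    have "{l \<in> {..<Suc k}. val i {j} \<le> val i {l}} = (if val i {j} \<le> val i {k}
        then insert k {l \<in> {..<k}. val i {j} \<le> val i {l}} else {l \<in> {..<k}. val i {j} \<le> val i {l}})"
      by (auto simp: less_Suc_eq)
    then show "runs orc c' s' (2 * X ^ 0) (I (Suc k))"
      unfolding c'_def by (intro runs_intros)
        (use k e in \<open>auto simp: I_def not_less\<close>)
  qed (use s size in \<open>auto simp: I_def nw\<close>)
  then show ?thesis unfolding c by (rule runs_mono) (simp_all add: I_def)
qed

text \<open>The array \<open>y\<close> is cleared after each query, so every queried set is a
  singleton and the next agent starts from a clean array.\<close>

lemma runs_query_singletons:
  assumes s: "nats s ''m'' 0 = m" "nats s ''a'' 0 = i" "i < n" "nats s ''y'' = (\<lambda>_. 0)"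
  shows "runs orc query_singletons s (7 * X) (\<lambda>s'. frame query_singletons s s' \<and>
    nats s' ''y'' = (\<lambda>_. 0) \<and> (\<forall>k<m. reals s' ''b'' k = val i {k}))"
proof -
  define c where "c = (Seq (NAssign ''y'' (V ''j'') (NConst 1))
        (Seq (Query ''b'' (V ''j'') (V ''a'') ''y'') (NAssign ''y'' (V ''j'') (NConst 0))))"
  have c: "query_singletons = loop ''j'' ''m'' c" by (simp add: query_singletons_def c_def)
  have nw: "nwritten c = {''y''}" "rwritten c = {''b''}" by (auto simp: c_def)
  define I where "I k s' \<longleftrightarrow> nats s' ''y'' = (\<lambda>_. 0) \<and> (\<forall>j<k. reals s' ''b'' j = val i {j})"
    for k :: nat and s' :: state
  have "runs orc (loop ''j'' ''m'' c) s ((3 + 4) * X ^ Suc 0)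
      (\<lambda>s'. I m s' \<and> frame (loop ''j'' ''m'' c) s s')"
  proof (rule runs_loop)
    fix k s' assume k: "k < m" "I k s'" "nats s' ''j'' 0 = k" and fr: "frame (loop ''j'' ''m'' c) s s'"
    have e: "nats s' ''a'' 0 = i" using frame_nats[OF fr] s by (simp add: nw)
    have "{j. j = k} = {k}" by auto
    then show "runs orc c s' (3 * X ^ 0) (I (Suc k))"
      unfolding c_def by (intro runs_intros)
        (use k e orc_eq[OF s(3), of "{k}"] in \<open>auto simp: I_def less_Suc_eq fun_eq_iff\<close>)
  qed (use s size in \<open>auto simp: I_def nw\<close>)
  then show ?thesis unfolding c by (rule runs_mono) (simp_all add: I_def)
qed

lemma runs_sum_frequent:
  assumes s: "nats s ''n'' 0 = n" "nats s ''m'' 0 = m" "nats s ''a'' 0 = i"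
    "\<forall>k<m. reals s ''b'' k = val i {k}"
  shows "runs orc sum_frequent s (13 * X ^ 2) (\<lambda>s'. frame sum_frequent s s' \<and>
    reals s' ''h'' = (reals s ''h'')(i := reals s ''h'' i + 11 / 30 * estimate i))"
proof -
  define c1 where "c1 = (loop ''k'' ''m'' (Cond (RLess (RElem ''b'' (V ''k'')) (RElem ''b'' (V ''j''))) Skip
            (NAssign ''c'' (NConst 0) (NPlus (V ''c'') (NConst 1)))))"
  define c2 where "c2 = (Cond (NLess (V ''c'') (V ''n'')) Skip
            (RAssign ''h'' (V ''a'') (RPlus (RElem ''h'' (V ''a''))
              (RScale (11 / 30) (RElem ''b'' (V ''j''))))))"
  define c where "c = Seq (NAssign ''c'' (NConst 0) (NConst 0)) (Seq c1 c2)"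
  have c: "sum_frequent = loop ''j'' ''m'' c" by (simp add: sum_frequent_def c_def c1_def c2_def)
  have nw: "nwritten c = {''c'', ''k''}" "rwritten c = {''h''}"
    by (auto simp: c_def c1_def c2_def)
  define I where "I k s' \<longleftrightarrow> reals s' ''h'' = (reals s ''h'')(i := reals s ''h'' i +
      11 / 30 * (\<Sum>j\<in>frequent i \<inter> {..<k}. val i {j}))"
    for k :: nat and s' :: state
  have "runs orc (loop ''j'' ''m'' c) s ((9 + 4) * X ^ Suc 1)
      (\<lambda>s'. I m s' \<and> frame (loop ''j'' ''m'' c) s s')"
  proof (rule runs_loop)
    fix k s' assume k: "k < m" "I k s'" "nats s' ''j'' 0 = k" and fr: "frame (loop ''j'' ''m'' c) s s'"
    let ?s = "nwrite ''c'' 0 0 s'"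
    have e: "nats ?s ''m'' 0 = m" "nats ?s ''c'' 0 = 0" "nats ?s ''j'' 0 = k"
      "\<forall>l<m. reals ?s ''b'' l = val i {l}"
      using frame_nats[OF fr] frame_reals[OF fr] s k by (simp_all add: nw)
    have e': "nats s' ''n'' 0 = n" "nats s' ''a'' 0 = i"
      using frame_nats[OF fr] s by (simp_all add: nw)
    have "runs orc (Seq c1 c2) ?s (6 * X + 2) (I (Suc k))"
    proof (rule runs_Seq_bound[OF runs_count[OF e k(1)], folded c1_def])
      fix s1 assume s1: "frame c1 ?s s1 \<and>
        nats s1 ''c'' 0 = card {l \<in> {..<m}. val i {k} \<le> val i {l}}"
      then have fr1: "frame c1 ?s s1" by blast
      have e1: "nats s1 ''n'' 0 = n" "nats s1 ''a'' 0 = i" "nats s1 ''j'' 0 = k"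
        "reals s1 ''b'' k = val i {k}" "reals s1 ''h'' = reals s' ''h''"
        using frame_nats[OF fr1] frame_reals[OF fr1] e e' k by (simp_all add: c1_def)
      have found: "nats s1 ''c'' 0 < n \<longleftrightarrow> k \<notin> frequent i"
        using s1 k(1) by (auto simp: frequent_def)
      have set: "frequent i \<inter> {..<Suc k} = (if k \<in> frequent i
          then insert k (frequent i \<inter> {..<k}) else frequent i \<inter> {..<k})"
        by (auto simp: less_Suc_eq)
      have "I (Suc k) s1" if "k \<notin> frequent i"
        using k(2) e1(5) that unfolding I_def set by simp
      moreover have "I (Suc k) (rwrite ''h'' i (reals s1 ''h'' i + 11 / 30 * val i {k}) s1)"
        if "k \<in> frequent i"
        using k(2) e1(5) that unfolding I_def set by (simp add: distrib_left add_ac)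
      moreover have rat: "of_rat (11 / 30) = (11 / 30 :: real)"
        by (simp add: of_rat_divide)
      ultimately show "runs orc c2 s1 2 (I (Suc k))"
        unfolding c2_def by (intro runs_intros) (use found e1 in \<open>simp_all add: rat\<close>)
    qed simp
    then have "runs orc c s' (6 * X + 2 + 1) (I (Suc k))"
      unfolding c_def by (intro runs_Seq_NAssign) simp_all
    then show "runs orc c s' (9 * X ^ 1) (I (Suc k))"
      by (rule runs_mono) (use size in simp_all)
  qed (use s size in \<open>auto simp: I_def nw\<close>)
  then show ?thesis unfolding c
  proof (rule runs_mono)
    have "frequent i \<inter> {..<m} = frequent i" by (auto simp: frequent_def)
    then show "frame (loop ''j'' ''m'' c) s s' \<and>
        reals s' ''h'' = (reals s ''h'')(i := reals s ''h'' i + 11 / 30 * estimate i)"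
      if "I m s' \<and> frame (loop ''j'' ''m'' c) s s'" for s'
      using that by (simp add: I_def estimate_def)
  qed (simp add: power2_eq_square)
qed

lemma runs_initialise:
  assumes s: "s = init_state n m"
  shows "runs orc initialise s (25 * X ^ 3) (\<lambda>s'. frame initialise s s' \<and>
    (\<forall>i<n. reals s' ''h'' i = 11 / 30 * estimate i))"
proof -
  define c where "c = Seq query_singletons sum_frequent"
  have c: "initialise = loop ''a'' ''n'' c"
    by (simp add: initialise_def c_def)
  have nw: "nwritten c = {''j'', ''k'', ''y'', ''c''}" "rwritten c = {''b'', ''h''}"
    by (auto simp: c_def query_singletons_def sum_frequent_def)
  \<comment> \<open>Entries of \<open>h\<close> not yet treated are still 0, the start value from
    which \<open>sum_frequent\<close> accumulates.\<close>
  define I where "I k s' \<longleftrightarrow> nats s' ''y'' = (\<lambda>_. 0) \<and>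
    (\<forall>i. reals s' ''h'' i = (if i < k then 11 / 30 * estimate i else 0))"
    for k :: nat and s' :: state
  have "runs orc (loop ''a'' ''n'' c) s ((21 + 4) * X ^ Suc 2)
      (\<lambda>s'. I n s' \<and> frame (loop ''a'' ''n'' c) s s')"
  proof (rule runs_loop)
    fix k s' assume k: "k < n" "I k s'" "nats s' ''a'' 0 = k" and fr: "frame (loop ''a'' ''n'' c) s s'"
    have e: "nats s' ''m'' 0 = m" "nats s' ''n'' 0 = n" "nats s' ''y'' = (\<lambda>_. 0)"
      using frame_nats[OF fr] s k by (simp_all add: nw init_state_def I_def)
    show "runs orc c s' (21 * X ^ 2) (I (Suc k))"
      unfolding c_def
    proof (rule runs_Seq_bound[OF runs_query_singletons[OF e(1) k(3,1) e(3)]])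
      fix s1 assume s1: "frame query_singletons s' s1 \<and>
        nats s1 ''y'' = (\<lambda>_. 0) \<and> (\<forall>l<m. reals s1 ''b'' l = val k {l})"
      then have fr1: "frame query_singletons s' s1" by blast
      have e1: "nats s1 ''n'' 0 = n" "nats s1 ''m'' 0 = m" "nats s1 ''a'' 0 = k"
        "\<forall>l<m. reals s1 ''b'' l = val k {l}" "reals s1 ''h'' = reals s' ''h''"
        using frame_nats[OF fr1] frame_reals[OF fr1] e k s1
        by (simp_all add: query_singletons_def)
      show "runs orc sum_frequent s1 (13 * X ^ 2) (I (Suc k))"
      proof (rule runs_mono[OF runs_sum_frequent[OF e1(1-4)]])
        fix s2 assume s2: "frame sum_frequent s1 s2 \<and>
          reals s2 ''h'' = (reals s1 ''h'')(k := reals s1 ''h'' k + 11 / 30 * estimate k)"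
        then have "nats s2 ''y'' = nats s1 ''y''"
          using frame_nats[of sum_frequent s1 s2 "''y''"] by (simp add: sum_frequent_def)
        then show "I (Suc k) s2" using s2 s1 e1 k(2) by (auto simp: I_def less_Suc_eq)
      qed simp
    next
      have "X * 1 \<le> X * X" by (rule mult_le_mono2) (rule size)
      then show "7 * X + 13 * X ^ 2 \<le> 21 * X ^ 2" by (simp add: power2_eq_square)
    qed
  qed (use s size in \<open>auto simp: I_def nw init_state_def\<close>)
  then show ?thesis unfolding c by (rule runs_mono) (simp_all add: I_def)
qed

section \<open>The main loop and the number of rounds\<close>

lemma runs_main:
  assumes K: "0 < K"
  shows "runs orc (main K) (init_state n m) (27 * X ^ 3 + (K * X ^ 2 + 1) * (64 * X ^ 3 + 1))
    (\<lambda>s. \<forall>i<n. real K / (real K + 1) * (11 / 30 * mms {..<m} n (val i)) \<le> val i (allotted m s i))"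
proof -
  define \<beta> where "\<beta> = real K / (real K + 1)"
  define M where "M i = 11 / 30 * mms {..<m} n (val i)" for i
  define B where "B i = 11 / 30 * estimate i" for i
  have \<beta>: "0 < \<beta>" "\<beta> \<le> 1" using K by (auto simp: \<beta>_def)
  have MB: "M i \<le> B i" "B i \<le> real m * M i" if "i < n" for i
    using mms_le_sum_frequent[OF hereditary, of n "v i"] sum_frequent_le[OF hereditary, of n "v i"] that
    by (auto simp: M_def B_def estimate_def frequent_def)
  have M0: "0 \<le> M i" if "i < n" for i
    using mms_nonneg[OF hereditary, of n "v i"] that by (simp add: M_def)
  \<comment> \<open>The witness \<open>f i\<close> counts how often the threshold of agent
    \<open>i\<close> was lowered from \<open>B i\<close>. Lowering happens only above
    \<open>M i\<close>, so the threshold stays at least \<open>\<beta> * M i\<close>. A round that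
    lowers something raises the sum of the \<open>f i\<close>; the final round does not, so
    \<open>r\<close> is bounded only while \<open>g\<close> is set.\<close>
  define I where "I r s \<longleftrightarrow> nats s ''n'' 0 = n \<and> nats s ''m'' 0 = m \<and> members s \<subseteq> {..<m} \<and>
    (\<forall>i<n. \<beta> * M i \<le> reals s ''h'' i) \<and>
    (nats s ''g'' 0 = 0 \<longrightarrow> (\<forall>i<n. reals s ''h'' i \<le> val i (allotted m s i))) \<and>
    (\<exists>f. (nats s ''g'' 0 \<noteq> 0 \<longrightarrow> r \<le> (\<Sum>i<n. f i)) \<and>
      (\<forall>i<n. f i \<le> K * m \<and> reals s ''h'' i = \<beta> ^ f i * B i))" for r :: nat and s :: state
  \<comment> \<open>At most \<open>n * (K * m)\<close> rounds lower a threshold, and one more round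
    lowers none.\<close>
  let ?N = "n * (K * m) + 1"
  let ?w = "While (NLess (NConst 0) (V ''g'')) (allocation_round K)"
  let ?Q = "\<lambda>s. \<forall>i<n. \<beta> * M i \<le> val i (allotted m s i)"
  have nw: "nwritten (allocation_round K) = {''g'', ''j'', ''owner'', ''i'', ''d'', ''a'', ''S'', ''k'', ''w''}"
    by (auto simp: allocation_round_def lower_def step_def collect_free_def shrink_def give_def scan_agents_def)
  have loop: "runs orc ?w s (?N * (64 * X ^ 3 + 1) + 1) ?Q" if s: "I 0 s" for s
  proof (rule runs_mono[OF runs_While[of I, OF s]])
    fix r s1 assume I: "I r s1" and b: "bval (NLess (NConst 0) (V ''g'')) s1"
    obtain f where f: "r \<le> (\<Sum>i<n. f i)" "\<And>i. i < n \<Longrightarrow> f i \<le> K * m"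
      "\<And>i. i < n \<Longrightarrow> reals s1 ''h'' i = \<beta> ^ f i * B i"
      using I b by (auto simp: I_def)
    have s1: "nats s1 ''n'' 0 = n" "nats s1 ''m'' 0 = m" "members s1 \<subseteq> {..<m}"
      and h1: "\<And>i. i < n \<Longrightarrow> \<beta> * M i \<le> reals s1 ''h'' i"
      using I by (simp_all add: I_def)
    have "(\<Sum>i<n. f i) \<le> (\<Sum>i<n. K * m)" by (rule sum_mono) (use f(2) in simp)
    then have r: "r < ?N" using f(1) by simp
    have "runs orc (allocation_round K) s1 (64 * X ^ 3) (I (Suc r))"
    proof (rule runs_mono[OF runs_round[OF s1, of K]])
      fix s2 assume s2: "frame (allocation_round K) s1 s2 \<and> members s2 \<subseteq> {..<m} \<and> (\<exists>W. round_result K s1 s2 W)"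
      then obtain W where "round_result K s1 s2 W" by blast
      then have W: "W \<subseteq> {..<n}" "nats s2 ''g'' 0 = 0 \<longleftrightarrow> W = {}"
        "\<And>i. i < n \<Longrightarrow> reals s2 ''h'' i = (if i \<in> W then \<beta> * reals s1 ''h'' i else reals s1 ''h'' i)"
        "\<And>i. i \<in> W \<Longrightarrow> M i < reals s1 ''h'' i"
        "\<And>i. i < n \<Longrightarrow> i \<notin> W \<Longrightarrow> reals s1 ''h'' i \<le> val i (allotted m s2 i)"
        unfolding round_result_def \<beta>_def M_def by simp_all
      have fr: "frame (allocation_round K) s1 s2" using s2 by blast
      have e: "nats s2 ''n'' 0 = n" "nats s2 ''m'' 0 = m"
        using frame_nats[OF fr] s1 by (simp_all add: nw)
      define f' where "f' i = (if i \<in> W then Suc (f i) else f i)" for i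
      have "f' i \<le> K * m \<and> reals s2 ''h'' i = \<beta> ^ f' i * B i" if i: "i < n" for i
      proof (cases "i \<in> W")
        case True
        \<comment> \<open>For \<open>i\<close> in \<open>W\<close> the current threshold
          \<open>\<beta> ^ f i * B i\<close> exceeds \<open>M i\<close>. Strictness leaves room for
          the reduction made in this round.\<close>
        have "f i < K * m"
          by (rule geometric_decrease_bound[OF K M0[OF i] MB(2)[OF i]])
            (use W(4)[OF True] f(3)[OF i] in \<open>simp add: \<beta>_def\<close>)
        then show ?thesis using True W(3)[OF i] f(3)[OF i] by (simp add: f'_def)
      qed (use W(3)[OF i] f(2,3)[OF i] in \<open>simp add: f'_def\<close>)
      moreover have "Suc r \<le> (\<Sum>i<n. f' i)" if ne: "W \<noteq> {}"
      proof -
        have "(\<Sum>i<n. f i) < (\<Sum>i<n. f' i)"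
          by (rule sum_strict_mono_ex1) (use ne W(1) in \<open>auto simp: f'_def\<close>)
        then show ?thesis using f(1) by simp
      qed
      moreover have "\<beta> * M i \<le> reals s2 ''h'' i" if "i < n" for i
        using W(3)[OF that] W(4)[of i] h1[OF that] \<beta>(1) by (auto simp: less_imp_le)
      moreover have "reals s2 ''h'' i \<le> val i (allotted m s2 i)" if "W = {}" "i < n" for i
        using W(3,5)[of i] that by simp
      ultimately show "I (Suc r) s2" using s2 e W(2) unfolding I_def by blast
    qed simp
    then show "r < ?N \<and> runs orc (allocation_round K) s1 (64 * X ^ 3) (I (Suc r))" using r by blast
  next
    fix s' assume "(\<exists>r. I r s') \<and> \<not> bval (NLess (NConst 0) (V ''g'')) s' \<and> frame (allocation_round K) s s'"
    then show "?Q s'" by (auto simp: I_def intro: order_trans)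
  qed simp
  have N: "?N \<le> K * X ^ 2 + 1"
  proof -
    have "n * m \<le> X * X" using size by (intro mult_le_mono)
    then have "K * (n * m) \<le> K * (X * X)" by (rule mult_le_mono2)
    then show ?thesis by (simp add: power2_eq_square algebra_simps)
  qed
  have "runs orc (main K) (init_state n m) (27 * X ^ 3 + (K * X ^ 2 + 1) * (64 * X ^ 3 + 1)) ?Q"
    unfolding main_def
  proof (rule runs_Seq_bound[OF runs_initialise[OF refl]])
    fix s assume *: "frame initialise (init_state n m) s \<and>
      (\<forall>i<n. reals s ''h'' i = 11 / 30 * estimate i)"
    then have fr: "frame initialise (init_state n m) s" by blast
    have s: "nats s ''n'' 0 = n" "nats s ''m'' 0 = m" "members s = {}"
      using frame_nats[OF fr] by (simp_all add: initialise_def query_singletons_def sum_frequent_def init_state_def members_def)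
    have h: "reals s ''h'' i = B i" if "i < n" for i using * that by (simp add: B_def)
    have "\<beta> * M i \<le> reals s ''h'' i" if "i < n" for i
      using mult_right_mono[OF \<beta>(2) M0[OF that]] MB(1)[OF that] h[OF that] by simp
    then have I0: "I 0 (nwrite ''g'' 0 1 s)"
      unfolding I_def using h s
      by (intro conjI exI[of _ "\<lambda>_. 0"]) (simp_all add: members_def)
    \<comment> \<open>The summand 2 pays for setting \<open>g\<close> and for the last test of the
      loop.\<close>
    have "?N * (64 * X ^ 3 + 1) + 1 \<le> 2 + (K * X ^ 2 + 1) * (64 * X ^ 3 + 1) - 1"
      using mult_le_mono1[OF N, of "64 * X ^ 3 + 1"] by linarith
    then have "runs orc ?w (nwrite ''g'' 0 1 s) (2 + (K * X ^ 2 + 1) * (64 * X ^ 3 + 1) - 1) ?Q"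
      by (rule runs_mono[OF loop[OF I0]])
    then show "runs orc (Seq (NAssign ''g'' (NConst 0) (NConst 1)) ?w) s
      (2 + (K * X ^ 2 + 1) * (64 * X ^ 3 + 1)) ?Q"
      by (intro runs_Seq_NAssign) simp_all
  next
    have "1 \<le> X ^ 3" using size by simp
    then show "25 * X ^ 3 + (2 + (K * X ^ 2 + 1) * (64 * X ^ 3 + 1)) \<le>
      27 * X ^ 3 + (K * X ^ 2 + 1) * (64 * X ^ 3 + 1)" by simp
  qed
  then show ?thesis by (simp add: \<beta>_def M_def)
qed

end

theorem theorem7:
  fixes \<delta> :: real
  assumes "0 < \<delta>" and "\<delta> < 1"
  shows "\<exists>(alg :: com) (C :: nat) (d :: nat).
    \<forall>(n :: nat) (m :: nat) (F :: nat set set) (v :: nat \<Rightarrow> nat \<Rightarrow> real)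
      (orc :: nat \<Rightarrow> nat set \<Rightarrow> real).
      hereditary_system {..<m} F \<longrightarrow>
      (\<forall>i<n. \<forall>j<m. 0 \<le> v i j) \<longrightarrow>
      (\<forall>i<n. \<forall>S\<subseteq>{..<m}. orc i S = valuation F (v i) S) \<longrightarrow>
      (\<exists>q t s. exec orc alg (init_state n m) q t s \<and>
         q \<le> C * (n + m + 1) ^ d \<and> t \<le> C * (n + m + 1) ^ d \<and>
         (\<forall>i<n. allotted m s i \<subseteq> {..<m}) \<and>
         disjoint_family_on (allotted m s) {..<n} \<and>
         (\<forall>i<n. valuation F (v i) (allotted m s i)
                  \<ge> (1 - \<delta>) * (11 / 30) * mms {..<m} n (valuation F (v i))))"
proof -
  \<comment> \<open>From \<open>K > 1 / \<delta>\<close> follows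
    \<open>1 / (K + 1) < \<delta>\<close>, so \<open>K / (K + 1)\<close> is at least
    \<open>1 - \<delta>\<close>. The choice depends on \<open>\<delta>\<close> alone, and hence so
    do the program and the constants.\<close>
  obtain K :: nat where K: "1 / \<delta> < real K" using reals_Archimedean2 by blast
  then have K0: "0 < K" using assms(1)
    by (metis less_trans of_nat_0_less_iff zero_less_divide_1_iff)
  have "1 < \<delta> * real K" using K assms(1) by (simp add: field_simps)
  then have ratio: "1 - \<delta> \<le> real K / (real K + 1)"
    using assms(1) by (simp add: field_simps)
  show ?thesis
  \<comment> \<open>Expanding the bound of \<open>runs_main\<close> gives
    \<open>64 * K * X ^ 5 + K * X ^ 2 + 91 * X ^ 3 + 1\<close>, which is at most
    \<open>(65 * K + 92) * X ^ 5\<close> because \<open>X\<close> is positive.\<close>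
  proof (rule exI[of _ "main K"], rule exI[of _ "65 * K + 92"], rule exI[of _ 5], intro allI impI)
    fix n m :: nat and F :: "nat set set" and v :: "nat \<Rightarrow> nat \<Rightarrow> real"
      and orc :: "nat \<Rightarrow> nat set \<Rightarrow> real"
    assume H: "hereditary_system {..<m} F" "\<forall>i<n. \<forall>j<m. 0 \<le> v i j"
      "\<forall>i<n. \<forall>S\<subseteq>{..<m}. orc i S = valuation F (v i) S"
    define X where "X = n + m + 1"
    interpret fair_division n m X F v orc
      by unfold_locales (use H in \<open>auto simp: X_def\<close>)
    obtain q t s where ex: "exec orc (main K) (init_state n m) q t s"
      and t: "t \<le> 27 * X ^ 3 + (K * X ^ 2 + 1) * (64 * X ^ 3 + 1)"
      and val: "\<forall>i<n. real K / (real K + 1) * (11 / 30 * mms {..<m} n (val i)) \<le> val i (allotted m s i)"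
      using runs_main[OF K0] unfolding runs_def by blast
    have X5: "X ^ 5 = X ^ 2 * X ^ 3" by (simp flip: power_add)
    have le: "X ^ 3 \<le> X ^ 5" "X ^ 2 \<le> X ^ 5" "1 \<le> X ^ 5"
      using size by (auto intro!: power_increasing)
    moreover have "K * X ^ 2 \<le> K * X ^ 5" using le(2) by (rule mult_le_mono2)
    moreover have "27 * X ^ 3 + (K * X ^ 2 + 1) * (64 * X ^ 3 + 1) =
        91 * X ^ 3 + 64 * (K * X ^ 5) + K * X ^ 2 + 1" unfolding X5 by (simp add: algebra_simps)
    moreover have "(65 * K + 92) * (n + m + 1) ^ 5 = 65 * (K * X ^ 5) + 92 * X ^ 5"
      unfolding X_def[symmetric] by (simp add: add_mult_distrib)
    ultimately have T: "t \<le> (65 * K + 92) * (n + m + 1) ^ 5" using t by linarith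
    have "(1 - \<delta>) * (11 / 30) * mms {..<m} n (val i) \<le> val i (allotted m s i)" if i: "i < n" for i
    proof -
      have "(1 - \<delta>) * (11 / 30) * mms {..<m} n (val i) = (1 - \<delta>) * (11 / 30 * mms {..<m} n (val i))"
        by (rule mult.assoc)
      also have "\<dots> \<le> real K / (real K + 1) * (11 / 30 * mms {..<m} n (val i))"
        by (rule mult_right_mono[OF ratio]) (use mms_nonneg[OF H(1), of n "v i"] i in simp)
      also have "\<dots> \<le> val i (allotted m s i)" using val i by blast
      finally show ?thesis .
    qed
    moreover have "q \<le> (65 * K + 92) * (n + m + 1) ^ 5"
      using queries_le_steps[OF ex] T by (rule order_trans)
    moreover have "\<forall>i<n. allotted m s i \<subseteq> {..<m}" "disjoint_family_on (allotted m s) {..<n}"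
      by (auto simp: allotted_def disjoint_family_on_def)
    ultimately show "\<exists>q t s. exec orc (main K) (init_state n m) q t s \<and>
        q \<le> (65 * K + 92) * (n + m + 1) ^ 5 \<and> t \<le> (65 * K + 92) * (n + m + 1) ^ 5 \<and>
        (\<forall>i<n. allotted m s i \<subseteq> {..<m}) \<and> disjoint_family_on (allotted m s) {..<n} \<and>
        (\<forall>i<n. (1 - \<delta>) * (11 / 30) * mms {..<m} n (val i) \<le> val i (allotted m s i))"
      using ex T by blast
  qed
qed

end
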